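(* Fundamental point-circle complexes are determined by one-dimensional Cauchy data. That is, let $w\in A_2^{-1}$, $u=w+e_1+e_2+e_3\in A_2^2$, $f_1=e_1-e_2$, $f_2=e_2-e_3$, $f_3=e_3-e_1$, and let the star-shaped region $\Sigma\subset A_2^0$, which divides the triangular lattice $A_2^0$ into three sectors of 120 degrees, be the union of the three sets $$\{w+e_3+if_1+jf_2\},\qquad\{w+e_1+if_2+jf_3\},\qquad\{w+e_2+if_3+jf_1\},$$ where in each case $i,j\ge0$ are integers with $\min(i,j)\le1$. Prescribe (generic) points $\mathsf p(\Sigma)$ in the plane subject to the single constraint that the three central circles $\mathsf c(u-e_k)$, $k=1,2,3$, where $\mathsf c(u-e_k)$ passes through the three points $\mathsf p(u-e_k-e_l)$, $l=1,2,3$, are concurrent (in a point to be $\mathsf p(u)$). Then there exists a unique fundamental point-circle complex with the prescribed points on $\Sigma$.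
   Context: $e_1,e_2,e_3$ is the standard basis of $\mathbb Z^3$ and $A_2^k=\{(n_1,n_2,n_3)\in\mathbb Z^3:n_1+n_2+n_3=k\}$; $A_2^0$ is regarded as a triangular lattice. A fundamental point-circle complex is a pair of maps $\mathsf p$ from the even sublattice $\{n_1+n_2+n_3\text{ even}\}$ of $\mathbb Z^3$ to points of $\mathbb R^2$ and $\mathsf c$ from the odd sublattice $\{n_1+n_2+n_3\text{ odd}\}$ to (non-oriented) circles of $\mathbb R^2$ such that the point and the circle attached to the two endpoints of any edge of $\mathbb Z^3$ are incident. (Circles may be lines and points may be at infinity, as usual in Möbius geometry.) Configurations are assumed generic: points and circles attached to nearby vertices and occurring in the construction are pairwise distinct, so that the circle through three points and the second intersection point of two circles are well defined; in particular the common point $\mathsf p(u)$ of circles attached to the neighbours of $u$ is different from the pairwise intersection points already attached to other vertices. *)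

theory Defs
  imports "HOL-Analysis.Analysis"
begin

text \<open>The Moebius plane: the Euclidean plane (identified with the complex numbers) together with
  one point \<open>None\<close> at infinity.  Its circles are the Euclidean circles of positive radius
  and the straight lines completed by the point at infinity.\<close>

type_synonym mpoint = "complex option"

definition mcircles :: "mpoint set set" where
  "mcircles = {Some ` sphere a r | a r. r > 0} \<union>
              {insert None (Some ` {z. inner a z = b}) | a b. a \<noteq> 0}"

abbreviation evec :: "3 \<Rightarrow> int ^ 3" where
  "evec k \<equiv> axis k 1"

definition A2 :: "int \<Rightarrow> (int ^ 3) set" where
  "A2 k = {n. n $ 1 + n $ 2 + n $ 3 = k}"

definition even_lattice :: "(int ^ 3) set" where
  "even_lattice = {n. even (n $ 1 + n $ 2 + n $ 3)}"

definition odd_lattice :: "(int ^ 3) set" where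
  "odd_lattice = {n. odd (n $ 1 + n $ 2 + n $ 3)}"

definition lattice_adj :: "int ^ 3 \<Rightarrow> int ^ 3 \<Rightarrow> bool" where
  "lattice_adj m n \<longleftrightarrow> (\<exists>k. n = m + evec k \<or> m = n + evec k)"

text \<open>Maps on a sublattice are extensional functions, so that equality of two complexes is
  equality on the sublattices.\<close>

definition point_circle_complex ::
    "(int ^ 3 \<Rightarrow> mpoint) \<Rightarrow> (int ^ 3 \<Rightarrow> mpoint set) \<Rightarrow> bool" where
  "point_circle_complex p c \<longleftrightarrow>
     p \<in> even_lattice \<rightarrow>\<^sub>E UNIV \<and> c \<in> odd_lattice \<rightarrow>\<^sub>E mcircles \<and>
     (\<forall>n\<in>even_lattice. \<forall>v\<in>odd_lattice. lattice_adj n v \<longrightarrow> p n \<in> c v)"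

text \<open>Nearby vertices are distinct vertices with a common neighbour (in particular they have
  the same parity).  Genericity asks that nearby vertices carry distinct objects: for
  instance, the six points on a circle \<open>c v\<close> are distinct, the six circles
  through a point \<open>p n\<close> are distinct, and the two points attached to the diagonally
  opposite even vertices of an elementary square are the two distinct intersection points of
  the two circles attached to its odd vertices.\<close>

definition nearby :: "int ^ 3 \<Rightarrow> int ^ 3 \<Rightarrow> bool" where
  "nearby m n \<longleftrightarrow> m \<noteq> n \<and> (\<exists>v. lattice_adj m v \<and> lattice_adj n v)"

definition generic_complex ::
    "(int ^ 3 \<Rightarrow> mpoint) \<Rightarrow> (int ^ 3 \<Rightarrow> mpoint set) \<Rightarrow> bool" where
  "generic_complex p c \<longleftrightarrow>
     (\<forall>m\<in>even_lattice. \<forall>n\<in>even_lattice. nearby m n \<longrightarrow> p m \<noteq> p n) \<and>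
     (\<forall>v\<in>odd_lattice. \<forall>v'\<in>odd_lattice. nearby v v' \<longrightarrow> c v \<noteq> c v')"

text \<open>The points and circles occurring in the construction from points \<open>q\<close> prescribed on a
  set \<open>S\<close> of even vertices.  A circle is drawn through three distinct points already attached
  to neighbours of an odd vertex.  On an elementary square with odd vertices \<open>v\<close>, \<open>v'\<close> and
  even vertices \<open>m\<close>, \<open>n\<close>, the point at \<open>n\<close> is the second intersection point of the circles at
  \<open>v\<close>, \<open>v'\<close>, the first one being the point at \<open>m\<close>; if the circles are tangent, the two points
  coincide.  These are relations since nothing is assumed about the agreement of different
  constructions at the same vertex.\<close>

inductive constructed_point :: "(int ^ 3) set \<Rightarrow> (int ^ 3 \<Rightarrow> mpoint) \<Rightarrow> int ^ 3 \<Rightarrow> mpoint \<Rightarrow> bool"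
  and constructed_circle :: "(int ^ 3) set \<Rightarrow> (int ^ 3 \<Rightarrow> mpoint) \<Rightarrow> int ^ 3 \<Rightarrow> mpoint set \<Rightarrow> bool"
  for S q where
  prescribed: "n \<in> S \<Longrightarrow> constructed_point S q n (q n)"
| circle_through:
    "\<lbrakk>lattice_adj n1 v; lattice_adj n2 v; lattice_adj n3 v;
      constructed_point S q n1 x1; constructed_point S q n2 x2; constructed_point S q n3 x3;
      distinct [x1, x2, x3]; C \<in> mcircles; {x1, x2, x3} \<subseteq> C\<rbrakk>
     \<Longrightarrow> constructed_circle S q v C"
| second_intersection:
    "\<lbrakk>v \<noteq> v'; m \<noteq> n;
      lattice_adj m v; lattice_adj m v'; lattice_adj n v; lattice_adj n v';
      constructed_circle S q v C; constructed_circle S q v' C'; constructed_point S q m y;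
      C \<inter> C' = {y, x}\<rbrakk>
     \<Longrightarrow> constructed_point S q n x"

text \<open>Genericity of the prescribed points: the construction never attaches the same point, or
  the same circle, to two nearby vertices.\<close>

definition generic_data :: "(int ^ 3) set \<Rightarrow> (int ^ 3 \<Rightarrow> mpoint) \<Rightarrow> bool" where
  "generic_data S q \<longleftrightarrow>
     (\<forall>m n x y. nearby m n \<and> constructed_point S q m x \<and> constructed_point S q n y \<longrightarrow> x \<noteq> y) \<and>
     (\<forall>v v' C C'. nearby v v' \<and> constructed_circle S q v C \<and> constructed_circle S q v' C' \<longrightarrow> C \<noteq> C')"

definition star_arm :: "int ^ 3 \<Rightarrow> int ^ 3 \<Rightarrow> int ^ 3 \<Rightarrow> (int ^ 3) set" where
  "star_arm a f g = {a + int i *s f + int j *s g | i j :: nat. min i j \<le> 1}"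

definition Sigma_star :: "int ^ 3 \<Rightarrow> (int ^ 3) set" where
  "Sigma_star w =
     (let f1 = evec 1 - evec 2; f2 = evec 2 - evec 3; f3 = evec 3 - evec 1
      in star_arm (w + evec 3) f1 f2 \<union> star_arm (w + evec 1) f2 f3 \<union> star_arm (w + evec 2) f3 f1)"

end

theory Submission
  imports Defs
begin

text \<open>Every elementary step of the construction is forced, so uniqueness is an induction over the
  construction; the content is that all constructions agree and that they reach every vertex.

  On \<open>A2 0\<close> call a triangle of side two, formed by the points \<open>u - e\<^sub>k - e\<^sub>l\<close> (or
  \<open>u + e\<^sub>k + e\<^sub>l\<close>), concurrent if its three corner circles have a common point, the future \<open>p u\<close>.
  A point inside a sector is the free corner of one upward and one downward triangle; each of them
  forces one circle through the point, and the two circles also share a known point, so the point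
  is their second intersection.  In this way the points on the star extend to \<open>A2 0\<close>, and every
  triangle except the prescribed central one is used exactly once.

  From a layer on which all triangles are concurrent one passes to the next layer by taking the
  common points.  The downward triangles of the new layer are concurrent in the old points.  For
  an upward triangle one uses that concurrency means reality of a multi-ratio of the six points:
  six circles of the configuration each carry two new and two old points, and multiplying their
  cross-ratios shows that the product of the multi-ratio of the new triangle and that of a downward
  triangle of the old layer is real.\<close>

section \<open>Homogeneous coordinates, and circles as zero sets of Hermitian forms\<close>

definition hc1 :: "mpoint \<Rightarrow> complex" where
  "hc1 x = (case x of None \<Rightarrow> 1 | Some z \<Rightarrow> z)"

definition hc2 :: "mpoint \<Rightarrow> complex" where
  "hc2 x = (case x of None \<Rightarrow> 0 | Some z \<Rightarrow> 1)"

text \<open>The determinant of two homogeneous coordinate vectors, hence \<open>z - w\<close> for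
  finite points; through it cross-ratios need no case distinction at infinity.\<close>

definition bracket :: "mpoint \<Rightarrow> mpoint \<Rightarrow> complex" where
  "bracket x y = hc1 x * hc2 y - hc2 x * hc1 y"

lemma bracket_eq_0_iff: "bracket x y = 0 \<longleftrightarrow> x = y"
  by (cases x; cases y) (auto simp: bracket_def hc1_def hc2_def)

lemma bracket_commute: "bracket x y = - bracket y x"
  by (simp add: bracket_def)

text \<open>The sesquilinear form of a Hermitian 2 by 2 matrix. For an indefinite form the zero set
  on the diagonal is a line if \<open>A = 0\<close> and a circle otherwise.\<close>

definition herm :: "real \<Rightarrow> complex \<Rightarrow> real \<Rightarrow> mpoint \<Rightarrow> mpoint \<Rightarrow> complex" where
  "herm A B D x y = of_real A * hc1 x * cnj (hc1 y) + B * hc1 x * cnj (hc2 y)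
     + cnj B * hc2 x * cnj (hc1 y) + of_real D * hc2 x * cnj (hc2 y)"

lemma herm_Some: "herm A B D (Some z) (Some z) = 0 \<longleftrightarrow> A * (cmod z)\<^sup>2 + 2 * Re (B * z) + D = 0"
  unfolding cmod_power2
  by (simp add: herm_def hc1_def hc2_def complex_eq_iff power2_eq_square algebra_simps)

lemma herm_None: "herm A B D None None = 0 \<longleftrightarrow> A = 0"
  by (simp add: herm_def hc1_def hc2_def)

lemma sphere_eq_herm:
  assumes "r > 0"
  shows "Some ` sphere a r = {x. herm 1 (- cnj a) ((cmod a)\<^sup>2 - r\<^sup>2) x x = 0}"
proof -
  have "dist a z = r \<longleftrightarrow> (cmod z)\<^sup>2 + 2 * Re (- cnj a * z) + ((cmod a)\<^sup>2 - r\<^sup>2) = 0" for z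
  proof -
    have "dist a z = r \<longleftrightarrow> (cmod (a - z))\<^sup>2 = r\<^sup>2"
      using assms by (auto simp: dist_norm)
    also have "\<dots> \<longleftrightarrow> (cmod z)\<^sup>2 + 2 * Re (- cnj a * z) + ((cmod a)\<^sup>2 - r\<^sup>2) = 0"
      unfolding cmod_power2 by (simp add: power2_eq_square algebra_simps)
    finally show ?thesis .
  qed
  then have "Some z \<in> Some ` sphere a r
      \<longleftrightarrow> herm 1 (- cnj a) ((cmod a)\<^sup>2 - r\<^sup>2) (Some z) (Some z) = 0" for z
    unfolding herm_Some by (auto simp: inj_image_mem_iff)
  moreover have "herm 1 (- cnj a) ((cmod a)\<^sup>2 - r\<^sup>2) None None \<noteq> 0"
    by (simp add: herm_None)
  ultimately show ?thesis
    by (intro set_eqI; rename_tac x; case_tac x) auto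
qed

lemma line_eq_herm:
  "insert None (Some ` {z. inner a z = b}) = {x. herm 0 (cnj a) (- 2 * b) x x = 0}"
proof -
  have "Some z \<in> insert None (Some ` {z. inner a z = b})
      \<longleftrightarrow> herm 0 (cnj a) (- 2 * b) (Some z) (Some z) = 0" for z
    unfolding herm_Some by (auto simp: inner_complex_def)
  then show ?thesis
    by (intro set_eqI; rename_tac x; case_tac x) (auto simp: herm_None)
qed

text \<open>Lines and circles become one kind of object, the zero sets of indefinite forms; the
  strict inequality is indefiniteness and excludes degenerate zero sets.\<close>

lemma mcircles_eq_herm:
  "C \<in> mcircles \<longleftrightarrow> (\<exists>A B D. A * D < (cmod B)\<^sup>2 \<and> C = {x. herm A B D x x = 0})"
proof
  assume "C \<in> mcircles"
  then consider a r where "r > 0" "C = Some ` sphere a r"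
    | a b where "a \<noteq> 0" "C = insert None (Some ` {z. inner a z = b})"
    unfolding mcircles_def by blast
  then show "\<exists>A B D. A * D < (cmod B)\<^sup>2 \<and> C = {x. herm A B D x x = 0}"
  proof cases
    case 1
    then show ?thesis
      by (intro exI[of _ 1] exI[of _ "- cnj a"] exI[of _ "(cmod a)\<^sup>2 - r\<^sup>2"])
        (simp add: sphere_eq_herm)
  next
    case 2
    then show ?thesis
      by (intro exI[of _ 0] exI[of _ "cnj a"] exI[of _ "- 2 * b"]) (simp add: line_eq_herm)
  qed
next
  assume "\<exists>A B D. A * D < (cmod B)\<^sup>2 \<and> C = {x. herm A B D x x = 0}"
  then obtain A B D where AD: "A * D < (cmod B)\<^sup>2" and C: "C = {x. herm A B D x x = 0}"
    by blast
  show "C \<in> mcircles"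
  proof (cases "A = 0")
    case True
    then have "cnj B \<noteq> 0" using AD by auto
    moreover have "C = insert None (Some ` {z. inner (cnj B) z = - D / 2})"
      unfolding line_eq_herm C using True by simp
    ultimately show ?thesis unfolding mcircles_def by blast
  next
    case False
    \<comment> \<open>Completing the square after division by \<open>A\<close>, which may be
      negative.\<close>
    define a r where "a = - cnj B / A" and "r = sqrt ((cmod B)\<^sup>2 - A * D) / \<bar>A\<bar>"
    have "r > 0" using AD False by (simp add: r_def)
    have "r\<^sup>2 = ((cmod B)\<^sup>2 - A * D) / A\<^sup>2"
      using AD by (simp add: r_def power_divide)
    moreover have "(cmod a)\<^sup>2 = (cmod B)\<^sup>2 / A\<^sup>2"
      by (simp add: a_def norm_divide power_divide)
    ultimately have "(cmod a)\<^sup>2 - r\<^sup>2 = A * D / A\<^sup>2"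
      by (simp add: diff_divide_distrib)
    then have D: "(cmod a)\<^sup>2 - r\<^sup>2 = D / A"
      using False by (simp add: power2_eq_square)
    have B: "- cnj a = B / A" by (simp add: a_def)
    have "A * herm 1 (B / A) (D / A) x x = herm A B D x x" for x
      using False by (simp add: herm_def field_simps)
    then have "herm 1 (B / A) (D / A) x x = 0 \<longleftrightarrow> herm A B D x x = 0" for x
      using False by (metis mult_eq_0_iff of_real_eq_0_iff)
    then have "C = Some ` sphere a r"
      unfolding sphere_eq_herm[OF \<open>r > 0\<close>] B D C by simp
    then show ?thesis using \<open>r > 0\<close> unfolding mcircles_def by blast
  qed
qed

text \<open>Expands \<open>x\<close> in the basis \<open>a\<close>, \<open>c\<close> of the space of homogeneous coordinates.\<close>

lemma herm_expand:
  "bracket a c * cnj (bracket a c) * herm A B D x x =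
     bracket x c * cnj (bracket x c) * herm A B D a a
   + bracket a x * cnj (bracket a x) * herm A B D c c
   + (bracket x c * cnj (bracket a x) * herm A B D a c
      + cnj (bracket x c * cnj (bracket a x) * herm A B D a c))"
  by (simp add: herm_def bracket_def algebra_simps)

text \<open>The Gram matrix at \<open>a\<close>, \<open>c\<close> is congruent to the coefficient
  matrix through a matrix of determinant \<open>bracket a c\<close>. So an indefinite form vanishing
  at two distinct points has a nonzero mixed value there.\<close>

lemma herm_det:
  "of_real (A * D - (cmod B)\<^sup>2) * (bracket a c * cnj (bracket a c)) =
     herm A B D a a * herm A B D c c - herm A B D a c * cnj (herm A B D a c)"
  unfolding of_real_diff complex_norm_square
  by (simp add: herm_def bracket_def algebra_simps)

text \<open>Reality of the cross-ratio with the denominator cleared, so that the condition stays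
  meaningful when \<open>d\<close> coincides with another point.\<close>

definition concyclic :: "mpoint \<Rightarrow> mpoint \<Rightarrow> mpoint \<Rightarrow> mpoint \<Rightarrow> bool" where
  "concyclic a b c d \<longleftrightarrow> Im (bracket a b * bracket c d * cnj (bracket a d * bracket c b)) = 0"

text \<open>In the basis \<open>a\<close>, \<open>c\<close> only the mixed value \<open>h\<close> of
  the form survives. It is nonzero, and \<open>b\<close> fixes it up to a real factor, so
  \<open>a\<close>, \<open>b\<close>, \<open>c\<close> alone describe the circle.\<close>

lemma concyclic_circle:
  assumes "a \<noteq> b" "a \<noteq> c" "b \<noteq> c" and "C \<in> mcircles" "a \<in> C" "b \<in> C" "c \<in> C"
  shows "C = {d. concyclic a b c d}"
proof -
  obtain A B D where AD: "A * D < (cmod B)\<^sup>2" and C: "C = {x. herm A B D x x = 0}"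
    using assms(4) by (auto simp: mcircles_eq_herm)
  define h where "h = herm A B D a c"
  have nz: "bracket a c \<noteq> 0" "bracket a b \<noteq> 0" "bracket b c \<noteq> 0" "bracket c b \<noteq> 0"
    using assms(1-3) by (auto simp: bracket_eq_0_iff)
  have h: "h \<noteq> 0"
    using herm_det[of A D B a c] AD nz assms(5) unfolding C h_def
    by (auto simp del: of_real_diff)
  have mem: "x \<in> C \<longleftrightarrow> Re (bracket x c * cnj (bracket a x) * h) = 0" for x
  proof -
    have "bracket a c * cnj (bracket a c) * herm A B D x x
        = of_real (2 * Re (bracket x c * cnj (bracket a x) * h))"
      using herm_expand[of a c A B D x] assms(5,7) unfolding C h_def complex_add_cnj by simp
    moreover have "x \<in> C \<longleftrightarrow> bracket a c * cnj (bracket a c) * herm A B D x x = 0"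
      using nz by (simp add: C)
    ultimately show ?thesis
      by (simp del: of_real_mult)
  qed
  define k where "k = bracket b c * cnj (bracket a b)"
  define g where "g = bracket b c * cnj (bracket a b) * h"
  have g: "Re g = 0" using mem[of b] assms(6) by (simp add: g_def)
  have g0: "g \<noteq> 0" using nz h by (simp add: g_def)
  have "d \<in> C \<longleftrightarrow> concyclic a b c d" for d
  proof -
    define y where "y = bracket d c * cnj (bracket a d)"
    \<comment> \<open>Multiplying by the positive number \<open>k * cnj k\<close> trades
      \<open>h\<close> for the purely imaginary \<open>g\<close>, which turns a vanishing real part
      into a vanishing imaginary part.\<close>
    have "y * h * (k * cnj k) = (y * cnj k) * g"
      by (simp add: g_def k_def)
    then have "y * h * of_real ((cmod k)\<^sup>2) = (y * cnj k) * g"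
      unfolding complex_norm_square .
    moreover have "Re (y * h * of_real t) = Re (y * h) * t" for t
      by simp
    ultimately have "Re (y * h) * (cmod k)\<^sup>2 = Re ((y * cnj k) * g)"
      by metis
    also have "\<dots> = - (Im (y * cnj k) * Im g)"
      using g by (simp only: times_complex.sel mult_zero_right diff_0)
    finally have "Re (y * h) * (cmod k)\<^sup>2 = - (Im (y * cnj k) * Im g)" .
    moreover have "(cmod k)\<^sup>2 \<noteq> 0" "Im g \<noteq> 0"
      using g0 g nz by (auto simp: k_def complex_eq_iff[of g])
    ultimately have "Re (y * h) = 0 \<longleftrightarrow> Im (y * cnj k) = 0"
      by (metis mult_eq_0_iff neg_equal_0_iff_equal)
    moreover have "bracket a b * bracket c d * cnj (bracket a d * bracket c b) = y * cnj k"
      by (simp add: y_def k_def bracket_commute[of c])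
    ultimately show ?thesis
      unfolding mem concyclic_def y_def by metis
  qed
  then show ?thesis by blast
qed

lemma mcircle_unique:
  assumes "distinct [a, b, c]" and "{a, b, c} \<subseteq> C" "{a, b, c} \<subseteq> C'" "C \<in> mcircles" "C' \<in> mcircles"
  shows "C = C'"
  using assms concyclic_circle[of a b c C] concyclic_circle[of a b c C'] by auto

text \<open>A form vanishing at \<open>a\<close> and \<open>c\<close> is given by its mixed value,
  which the factor \<open>k\<close> adjusts so that \<open>b\<close> becomes a zero too. That this
  value is nonzero yields indefiniteness.\<close>

lemma mcircle_exists:
  assumes "distinct [a, b, c]"
  shows "\<exists>C\<in>mcircles. {a, b, c} \<subseteq> C"
proof -
  \<comment> \<open>The imaginary unit makes the first summand of the value at \<open>b\<close>
    imaginary, so that it cancels against its conjugate.\<close>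
  define k where "k = \<i> * cnj (bracket b c) * bracket a b"
  define A where "A = - 2 * Re (hc2 c * cnj (hc2 a) * k)"
  define B where "B = k * hc2 c * cnj (hc1 a) + cnj (k * hc1 c * cnj (hc2 a))"
  define D where "D = - 2 * Re (hc1 c * cnj (hc1 a) * k)"
  have A: "complex_of_real A = - (hc2 c * cnj (hc2 a) * k + cnj (hc2 c * cnj (hc2 a) * k))"
    unfolding A_def complex_add_cnj by simp
  have D: "complex_of_real D = - (hc1 c * cnj (hc1 a) * k + cnj (hc1 c * cnj (hc1 a) * k))"
    unfolding D_def complex_add_cnj by simp
  have H: "herm A B D x y = bracket x c * cnj (bracket a y) * k + cnj (bracket y c * cnj (bracket a x) * k)"
    for x y
    unfolding herm_def A D B_def by (simp add: bracket_def algebra_simps)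
  have refl: "bracket x x = 0" for x
    by (simp add: bracket_eq_0_iff)
  have nz: "bracket a c \<noteq> 0" "k \<noteq> 0"
    using assms by (auto simp: bracket_eq_0_iff k_def)
  have aa: "herm A B D a a = 0" and cc: "herm A B D c c = 0"
    by (simp_all add: H refl)
  have bb: "herm A B D b b = 0"
    by (simp add: H k_def)
  have ac: "herm A B D a c = bracket a c * cnj (bracket a c) * k"
    by (simp add: H refl)
  have "of_real (A * D - (cmod B)\<^sup>2) * (bracket a c * cnj (bracket a c))
      = - (herm A B D a c * cnj (herm A B D a c))"
    unfolding herm_det by (simp add: aa cc)
  then have "of_real ((A * D - (cmod B)\<^sup>2) * (cmod (bracket a c))\<^sup>2)
      = complex_of_real (- (cmod (herm A B D a c))\<^sup>2)"
    unfolding of_real_mult of_real_minus complex_norm_square .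
  then have "(A * D - (cmod B)\<^sup>2) * (cmod (bracket a c))\<^sup>2 = - (cmod (herm A B D a c))\<^sup>2"
    unfolding of_real_eq_iff .
  moreover have "(cmod (herm A B D a c))\<^sup>2 > 0" "(cmod (bracket a c))\<^sup>2 > 0"
    using nz by (simp_all add: ac)
  ultimately have "A * D < (cmod B)\<^sup>2"
    by (smt (verit) mult_nonneg_nonneg)
  then show ?thesis
    using aa bb cc by (intro bexI[of _ "{x. herm A B D x x = 0}"]) (auto simp: mcircles_eq_herm)
qed

text \<open>A third common point would make the circles equal. Tangency is the case
  \<open>x = y\<close>, in accordance with \<open>second_intersection\<close>.\<close>

lemma mcircle_Int_mcircle:
  assumes "C \<in> mcircles" "C' \<in> mcircles" "C \<noteq> C'" "y \<in> C" "y \<in> C'"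
  shows "\<exists>x. C \<inter> C' = {y, x}"
proof (cases "C \<inter> C' = {y}")
  case True
  then show ?thesis by (intro exI[of _ y]) simp
next
  case False
  then obtain x where x: "x \<in> C" "x \<in> C'" "x \<noteq> y" using assms by blast
  have "z = x \<or> z = y" if "z \<in> C" "z \<in> C'" for z
    using mcircle_unique[of x y z C C'] that x assms by auto
  then have "C \<inter> C' = {y, x}" using x assms by blast
  then show ?thesis ..
qed

section \<open>Cross-ratios and the incidence theorem behind the layer step\<close>

definition cross :: "mpoint \<Rightarrow> mpoint \<Rightarrow> mpoint \<Rightarrow> mpoint \<Rightarrow> complex" where
  "cross a b c d = bracket a b * bracket c d / (bracket a d * bracket c b)"

lemma cross_real_iff_concyclic:
  assumes "a \<noteq> d" "b \<noteq> c"
  shows "cross a b c d \<in> \<real> \<longleftrightarrow> concyclic a b c d"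
proof -
  have nz: "bracket a d * bracket c b \<noteq> 0" using assms by (auto simp: bracket_eq_0_iff)
  show ?thesis
    unfolding cross_def concyclic_def complex_is_Real_iff
    using nz by (subst complex_div_cnj) (simp only: Im_divide_of_real norm_eq_zero
        power_eq_0_iff divide_eq_0_iff simp_thms zero_less_numeral)
qed

lemma cross_real:
  assumes "C \<in> mcircles" "{a, b, c, d} \<subseteq> C" "distinct [a, b, c, d]"
  shows "cross a b c d \<in> \<real>" "cross a b c d \<noteq> 0"
proof -
  have "concyclic a b c d" using concyclic_circle[of a b c C] assms by auto
  then show "cross a b c d \<in> \<real>" using assms by (auto simp: cross_real_iff_concyclic)
  show "cross a b c d \<noteq> 0" using assms by (auto simp: cross_def bracket_eq_0_iff)
qed

lemma mem_circle_if_cross_real: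
  assumes "C \<in> mcircles" "{a, b, d} \<subseteq> C" "distinct [a, b, c, d]" "cross a b c d \<in> \<real>"
  shows "c \<in> C"
proof -
  have "concyclic a b c d" using assms by (auto simp: cross_real_iff_concyclic)
  \<comment> \<open>Exchanging \<open>a\<close> with \<open>b\<close> and \<open>c\<close> with
    \<open>d\<close> does not change the defining expression, and it moves the unknown point
    \<open>c\<close> to the last place.\<close>
  then have "concyclic b a d c"
    by (simp add: concyclic_def bracket_commute[of b a] bracket_commute[of d c]
        bracket_commute[of b c] bracket_commute[of d a] mult.commute)
  then show ?thesis using concyclic_circle[of b a d C] assms by auto
qed

definition cocircular :: "mpoint list \<Rightarrow> bool" where
  "cocircular xs \<longleftrightarrow> distinct xs \<and> (\<exists>C\<in>mcircles. set xs \<subseteq> C)"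

lemma cocircular_cross:
  assumes "cocircular [a, b, c, d]"
  shows "cross a b c d \<in> \<real>" "cross a b c d \<noteq> 0"
  using assms cross_real unfolding cocircular_def by auto

text \<open>Each of the two concurrency statements says that a multi-ratio of six points is real; the
  cross-ratios of the first six circles combine to the product of the two multi-ratios.\<close>

lemma concurrent_circles:
  assumes c: "cocircular [a1, b3, m3, n1]" "cocircular [a2, b3, m3, n2]"
      "cocircular [a2, b1, m1, n2]" "cocircular [a3, b1, m1, n3]"
      "cocircular [a3, b2, m2, n3]" "cocircular [a1, b2, m2, n1]"
    and e: "cocircular [m1, n2, y, n3]" "cocircular [m2, n3, y, n1]" "cocircular [m3, n1, y, n2]"
    and d: "cocircular [a1, b3, x, b2]" "cocircular [a2, b1, x, b3]"
    and D: "D \<in> mcircles" "{a3, b2, b1} \<subseteq> D" "distinct [a3, b2, x, b1]"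
  shows "x \<in> D"
proof -
  have nz: "bracket a1 n1 \<noteq> 0" "bracket a2 n2 \<noteq> 0" "bracket a3 n3 \<noteq> 0"
    "bracket m1 b1 \<noteq> 0" "bracket m2 b2 \<noteq> 0" "bracket m3 b3 \<noteq> 0"
    "bracket y n1 \<noteq> 0" "bracket y n2 \<noteq> 0" "bracket y n3 \<noteq> 0"
    "bracket x b1 \<noteq> 0" "bracket x b2 \<noteq> 0" "bracket x b3 \<noteq> 0"
    and nz': "bracket m3 n1 \<noteq> 0" "bracket m1 n2 \<noteq> 0" "bracket m2 n3 \<noteq> 0"
    "bracket m3 n2 \<noteq> 0" "bracket m1 n3 \<noteq> 0" "bracket m2 n1 \<noteq> 0"
    "bracket a1 b3 \<noteq> 0" "bracket a2 b1 \<noteq> 0"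
    "bracket a1 b2 \<noteq> 0" "bracket a2 b3 \<noteq> 0"
    using c e d D unfolding cocircular_def bracket_eq_0_iff by auto
  \<comment> \<open>The two circles of a quotient share a pair \<open>b\<close>, \<open>m\<close>,
    whose bracket cancels. The trailing factors in \<open>a\<close> and \<open>n\<close> are
    arranged to cancel cyclically in the product of the three quotients.\<close>
  have R: "cross a1 b3 m3 n1 / cross a2 b3 m3 n2
      = bracket a1 b3 * bracket m3 n1 / (bracket a2 b3 * bracket m3 n2) * (bracket a2 n2 / bracket a1 n1)"
    "cross a2 b1 m1 n2 / cross a3 b1 m1 n3
      = bracket a2 b1 * bracket m1 n2 / (bracket a3 b1 * bracket m1 n3) * (bracket a3 n3 / bracket a2 n2)"
    "cross a3 b2 m2 n3 / cross a1 b2 m2 n1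
      = bracket a3 b2 * bracket m2 n3 / (bracket a1 b2 * bracket m2 n1) * (bracket a1 n1 / bracket a3 n3)"
    using nz unfolding cross_def by (simp_all add: divide_simps)
  have 1: "cross a1 b3 m3 n1 / cross a2 b3 m3 n2 * (cross a2 b1 m1 n2 / cross a3 b1 m1 n3)
      * (cross a3 b2 m2 n3 / cross a1 b2 m2 n1)
    = (bracket a1 b3 * bracket a2 b1 * bracket a3 b2 / (bracket a2 b3 * bracket a3 b1 * bracket a1 b2))
      * (bracket m3 n1 * bracket m1 n2 * bracket m2 n3 / (bracket m3 n2 * bracket m1 n3 * bracket m2 n1))"
    unfolding R using nz nz' by (simp add: divide_simps)
  \<comment> \<open>The brackets containing \<open>y\<close> cancel cyclically and leave the
    multi-ratio of the six points; those containing \<open>x\<close> do so in the next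
    identity.\<close>
  have 2: "cross m1 n2 y n3 * cross m2 n3 y n1 * cross m3 n1 y n2
    = bracket m3 n1 * bracket m1 n2 * bracket m2 n3 / (bracket m3 n2 * bracket m1 n3 * bracket m2 n1)"
    using nz unfolding cross_def by (simp add: divide_simps)
  have 3: "cross a1 b3 x b2 * cross a2 b1 x b3 * cross a3 b2 x b1
    = bracket a1 b3 * bracket a2 b1 * bracket a3 b2 / (bracket a2 b3 * bracket a3 b1 * bracket a1 b2)"
    using nz unfolding cross_def by (simp add: divide_simps)
  \<comment> \<open>Solving for the single cross-ratio whose reality is not yet known.\<close>
  have "cross a3 b2 x b1 =
      cross a1 b3 m3 n1 / cross a2 b3 m3 n2 * (cross a2 b1 m1 n2 / cross a3 b1 m1 n3)
      * (cross a3 b2 m2 n3 / cross a1 b2 m2 n1)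
      / (cross m1 n2 y n3 * cross m2 n3 y n1 * cross m3 n1 y n2)
      / (cross a1 b3 x b2 * cross a2 b1 x b3)"
  proof -
    have "cross m1 n2 y n3 * cross m2 n3 y n1 * cross m3 n1 y n2 \<noteq> 0"
      "cross a1 b3 x b2 * cross a2 b1 x b3 \<noteq> 0"
      using cocircular_cross(2)[OF e(1)] cocircular_cross(2)[OF e(2)] cocircular_cross(2)[OF e(3)]
        cocircular_cross(2)[OF d(1)] cocircular_cross(2)[OF d(2)] by auto
    then show ?thesis
      unfolding 1 2[symmetric] 3[symmetric] by simp
  qed
  moreover have "\<dots> \<in> \<real>"
    using cocircular_cross(1)[OF c(1)] cocircular_cross(1)[OF c(2)] cocircular_cross(1)[OF c(3)]
      cocircular_cross(1)[OF c(4)] cocircular_cross(1)[OF c(5)] cocircular_cross(1)[OF c(6)]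
      cocircular_cross(1)[OF e(1)] cocircular_cross(1)[OF e(2)] cocircular_cross(1)[OF e(3)]
      cocircular_cross(1)[OF d(1)] cocircular_cross(1)[OF d(2)]
    by (intro Reals_mult Reals_divide)
  ultimately show ?thesis
    using mem_circle_if_cross_real[of D a3 b2 b1 x] D by simp
qed

section \<open>Coordinates for local configurations of the lattice\<close>

text \<open>Incidences are checked in coordinates with respect to a signed, permuted standard basis; one
  lemma then covers all orientations of a local configuration.\<close>

definition frame :: "(3 \<Rightarrow> int ^ 3) \<Rightarrow> bool" where
  "frame d \<longleftrightarrow> (\<exists>s \<pi>. (s = 1 \<or> s = -1) \<and> inj \<pi> \<and> d = (\<lambda>l. s *s evec (\<pi> l)))"

definition pos :: "(3 \<Rightarrow> int ^ 3) \<Rightarrow> int ^ 3 \<Rightarrow> int \<Rightarrow> int \<Rightarrow> int \<Rightarrow> int ^ 3" where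
  "pos d u i j k = u + i *s d 1 + j *s d 2 + k *s d 3"

lemma vec3_eq_iff: "(x :: 'a ^ 3) = y \<longleftrightarrow> x $ 1 = y $ 1 \<and> x $ 2 = y $ 2 \<and> x $ 3 = y $ 3"
  by (simp add: vec_eq_iff forall_3)

lemma minus_scale_vec: "(- s) *s (x :: int ^ 3) = - (s *s x)"
  by (simp add: vec_eq_iff)

lemma lattice_adj_commute: "lattice_adj m n \<longleftrightarrow> lattice_adj n m"
  by (auto simp: lattice_adj_def)

lemma lattice_adj_signed:
  assumes "s = 1 \<or> s = -1" "n = m + s *s evec k"
  shows "lattice_adj m n"
  using assms by (auto simp: lattice_adj_def intro!: exI[of _ k] simp: vec_eq_iff)

lemma lattice_adj_pos:
  assumes "frame d"
    and "(i', j', k') \<in> {(i + 1, j, k), (i - 1, j, k), (i, j + 1, k), (i, j - 1, k),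
      (i, j, k + 1), (i, j, k - 1)}"
  shows "lattice_adj (pos d u i j k) (pos d u i' j' k')"
proof -
  obtain s \<pi> where s: "s = 1 \<or> s = -1" and d: "d = (\<lambda>l. s *s evec (\<pi> l))"
    using assms(1) by (auto simp: frame_def)
  have "pos d u (i + 1) j k = pos d u i j k + 1 *s d 1" "pos d u (i - 1) j k = pos d u i j k + (-1) *s d 1"
    "pos d u i (j + 1) k = pos d u i j k + 1 *s d 2" "pos d u i (j - 1) k = pos d u i j k + (-1) *s d 2"
    "pos d u i j (k + 1) = pos d u i j k + 1 *s d 3" "pos d u i j (k - 1) = pos d u i j k + (-1) *s d 3"
    by (simp_all add: pos_def vec_eq_iff algebra_simps)
  then have "\<exists>l t. (t = 1 \<or> t = -1) \<and> pos d u i' j' k' = pos d u i j k + t *s d l"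
    using assms(2) by blast
  then obtain l t where "t = 1 \<or> t = -1" "pos d u i' j' k' = pos d u i j k + t *s d l"
    by blast
  then have "pos d u i' j' k' = pos d u i j k + (t * s) *s evec (\<pi> l)" "t * s = 1 \<or> t * s = -1"
    using s by (auto simp: d)
  then show ?thesis using lattice_adj_signed by blast
qed

lemma pos_eq_iff:
  assumes "frame d"
  shows "pos d u i j k = pos d u i' j' k' \<longleftrightarrow> i = i' \<and> j = j' \<and> k = k'"
proof -
  obtain s \<pi> where s: "s = 1 \<or> s = -1" and \<pi>: "inj \<pi>" and d: "d = (\<lambda>l. s *s evec (\<pi> l))"
    using assms(1) by (auto simp: frame_def)
  have "\<pi> 1 \<noteq> \<pi> 2" "\<pi> 1 \<noteq> \<pi> 3" "\<pi> 2 \<noteq> \<pi> 3"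
    using \<pi> by (auto simp: inj_eq)
  then have "pos d u i j k $ \<pi> 1 = u $ \<pi> 1 + s * i" "pos d u i j k $ \<pi> 2 = u $ \<pi> 2 + s * j"
    "pos d u i j k $ \<pi> 3 = u $ \<pi> 3 + s * k" for i j k
    by (auto simp: pos_def d axis_def)
  then show ?thesis using s by (metis add_left_cancel mult_left_cancel zero_neq_neg_one zero_neq_one)
qed

lemma pos_0: "pos d u 0 0 0 = u"
  by (simp add: pos_def)

lemma constructed_circle_mcircles: "constructed_circle S q v C \<Longrightarrow> C \<in> mcircles"
  by (erule constructed_circle.cases) simp

lemma A2_evec_sum: "evec k $ 1 + evec k $ 2 + evec k $ 3 = 1"
  using exhaust_3[of k] by (auto simp: axis_def)

lemma evec_bounds: "0 \<le> evec k $ i" "evec k $ i \<le> 1"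
  by (simp_all add: axis_def)

section \<open>The star and the three sectors\<close>

text \<open>In the sector belonging to \<open>a\<close>, \<open>b\<close> the step numbers are
  \<open>i = n $ a - w $ a\<close> and \<open>j = w $ b + 1 - n $ b\<close>; the two bounds say that
  both are at least 2.\<close>

definition inner_sector :: "int ^ 3 \<Rightarrow> 3 \<Rightarrow> 3 \<Rightarrow> (int ^ 3) set" where
  "inner_sector w a b = {n. n $ a - w $ a \<ge> 2 \<and> n $ b - w $ b \<le> -1}"

lemma Sigma_star_subset_A2:
  assumes "w \<in> A2 (-1)"
  shows "Sigma_star w \<subseteq> A2 0"
  using assms by (auto simp: Sigma_star_def star_arm_def A2_def axis_def Let_def)

lemma Sigma_star_iff:
  assumes "w \<in> A2 (-1)" "n \<in> A2 0"
  shows "n \<in> Sigma_star w \<longleftrightarrow> n \<notin> inner_sector w 1 3 \<and> n \<notin> inner_sector w 2 1 \<and> n \<notin> inner_sector w 3 2"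
proof
  assume "n \<in> Sigma_star w"
  then obtain i j :: nat where ij: "i \<le> 1 \<or> j \<le> 1"
    and n: "n = w + evec 3 + int i *s (evec 1 - evec 2) + int j *s (evec 2 - evec 3)
      \<or> n = w + evec 1 + int i *s (evec 2 - evec 3) + int j *s (evec 3 - evec 1)
      \<or> n = w + evec 2 + int i *s (evec 3 - evec 1) + int j *s (evec 1 - evec 2)"
    unfolding Sigma_star_def star_arm_def Let_def min_le_iff_disj by blast
  then have "n $ 1 = w $ 1 + i \<and> n $ 2 = w $ 2 - i + j \<and> n $ 3 = w $ 3 + 1 - j
      \<or> n $ 2 = w $ 2 + i \<and> n $ 3 = w $ 3 - i + j \<and> n $ 1 = w $ 1 + 1 - j
      \<or> n $ 3 = w $ 3 + i \<and> n $ 1 = w $ 1 - i + j \<and> n $ 2 = w $ 2 + 1 - j"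
    by (auto simp: axis_def)
  then show "n \<notin> inner_sector w 1 3 \<and> n \<notin> inner_sector w 2 1 \<and> n \<notin> inner_sector w 3 2"
    using ij unfolding inner_sector_def mem_Collect_eq by (elim disjE; linarith)
next
  assume not_inner: "n \<notin> inner_sector w 1 3 \<and> n \<notin> inner_sector w 2 1 \<and> n \<notin> inner_sector w 3 2"
  have sum: "n $ 1 + n $ 2 + n $ 3 = w $ 1 + w $ 2 + w $ 3 + 1"
    using assms by (simp add: A2_def)
  have arm: "n \<in> star_arm (w + evec c) (evec a - evec b) (evec b - evec c)"
    if "(a, b, c) \<in> {(1, 2, 3), (2, 3, 1), (3, 1, 2)}"
      "n \<notin> inner_sector w a c" "n $ a \<ge> w $ a" "n $ c \<le> w $ c + 1" for a b c
  proof -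
    have "int (nat (n $ a - w $ a)) = n $ a - w $ a"
      "int (nat (w $ c + 1 - n $ c)) = w $ c + 1 - n $ c"
      using that(3,4) by simp_all
    moreover have "n = w + evec c + (n $ a - w $ a) *s (evec a - evec b)
        + (w $ c + 1 - n $ c) *s (evec b - evec c)"
      using that(1) sum by (elim insertE emptyE) (simp_all add: vec3_eq_iff axis_def)
    ultimately have "n = w + evec c + int (nat (n $ a - w $ a)) *s (evec a - evec b)
        + int (nat (w $ c + 1 - n $ c)) *s (evec b - evec c)"
      by metis
    moreover have "min (nat (n $ a - w $ a)) (nat (w $ c + 1 - n $ c)) \<le> 1"
      using that(2) unfolding inner_sector_def by simp linarith
    ultimately show ?thesis unfolding star_arm_def by blast
  qed
  \<comment> \<open>The coordinates relative to \<open>w\<close> sum to 1, which forces one of the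
    three sectors to contain \<open>n\<close>.\<close>
  consider "n $ 1 \<ge> w $ 1" "n $ 3 \<le> w $ 3 + 1" | "n $ 2 \<ge> w $ 2" "n $ 1 \<le> w $ 1 + 1"
    | "n $ 3 \<ge> w $ 3" "n $ 2 \<le> w $ 2 + 1"
    using sum by linarith
  then show "n \<in> Sigma_star w"
    using arm[of 1 2 3] arm[of 2 3 1] arm[of 3 1 2] not_inner
    unfolding Sigma_star_def Let_def by cases auto
qed

text \<open>No coordinate exceeds that of \<open>w\<close> by more than 1, whereas an inner sector
  requires 2. Hence the concurrency hypothesis concerns prescribed points only.\<close>

lemma central_in_Sigma_star:
  assumes "w \<in> A2 (-1)"
  shows "w + evec 1 + evec 2 + evec 3 - evec j - evec l \<in> Sigma_star w"
proof -
  let ?n = "w + evec 1 + evec 2 + evec 3 - evec j - evec l"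
  have "?n \<in> A2 0"
    using assms A2_evec_sum[of 1] A2_evec_sum[of 2] A2_evec_sum[of 3] A2_evec_sum[of j]
      A2_evec_sum[of l] by (simp add: A2_def)
  moreover have "?n $ i - w $ i \<le> 1" for i
    using exhaust_3[of i] evec_bounds(1)[of j i] evec_bounds(1)[of l i] by (auto simp: axis_def)
  then have "?n \<notin> inner_sector w a b" for a b
    unfolding inner_sector_def by (smt (verit) mem_Collect_eq)
  ultimately show ?thesis using Sigma_star_iff[OF assms] by blast
qed

text \<open>The measure for the recursion that fills the sectors; it vanishes on the star.\<close>

definition sector_depth :: "int ^ 3 \<Rightarrow> int ^ 3 \<Rightarrow> nat" where
  "sector_depth w n = (\<Sum>(a, b)\<in>{(1, 3), (2, 1), (3, 2)}.
     if n \<in> inner_sector w a b then nat ((n $ a - w $ a) - (n $ b - w $ b)) else 0)"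

lemma inner_sector_disjoint:
  assumes "w \<in> A2 (-1)" "n \<in> A2 0" "n \<in> inner_sector w a b" "n \<in> inner_sector w a' b'"
    "(a, b) \<in> {(1, 3), (2, 1), (3, 2)}" "(a', b') \<in> {(1, 3), (2, 1), (3, 2)}"
  shows "a = a' \<and> b = b'"
  using assms by (auto simp: inner_sector_def A2_def)

text \<open>The bounds on \<open>n'\<close> hold for all points of the two triangles having
  \<open>n\<close> as free corner. In step numbers the depth is \<open>i + j - 1\<close>; it drops
  along the sector and is zero once \<open>n'\<close> has left it.\<close>

lemma sector_depth_less:
  assumes "w \<in> A2 (-1)" "n \<in> A2 0" "n' \<in> A2 0" "n \<in> inner_sector w a b"
    and ab: "(a, b) \<in> {(1, 3), (2, 1), (3, 2)}"
    and n': "n' \<noteq> n" "n $ a - 2 \<le> n' $ a" "n' $ a \<le> n $ a" "n $ b \<le> n' $ b" "n' $ b \<le> n $ b + 2"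
  shows "sector_depth w n' < sector_depth w n"
proof -
  have "n' $ a < n $ a \<or> n $ b < n' $ b"
  proof (rule ccontr)
    assume "\<not> ?thesis"
    then have "n' = n" using assms(2,3) ab n' by (auto simp: A2_def vec3_eq_iff)
    with n' show False by simp
  qed
  then have less: "(n' $ a - w $ a) - (n' $ b - w $ b) < (n $ a - w $ a) - (n $ b - w $ b)"
    using n' by linarith
  have sum: "n $ 1 + n $ 2 + n $ 3 = w $ 1 + w $ 2 + w $ 3 + 1" "n' $ 1 + n' $ 2 + n' $ 3 = n $ 1 + n $ 2 + n $ 3"
    using assms(1-3) by (simp_all add: A2_def)
  have inner: "n $ a - w $ a \<ge> 2" "n $ b - w $ b \<le> -1"
    using assms(4) by (simp_all add: inner_sector_def)
  have pos: "0 < nat ((n $ a - w $ a) - (n $ b - w $ b))"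
    using inner by linarith
  consider "a = 1" "b = 3" | "a = 2" "b = 1" | "a = 3" "b = 2" using ab by blast
  then show ?thesis
  proof cases
    case 1
    have "n \<notin> inner_sector w 2 1" "n' \<notin> inner_sector w 2 1" "n \<notin> inner_sector w 3 2" "n' \<notin> inner_sector w 3 2"
      using inner n' sum unfolding inner_sector_def mem_Collect_eq 1 by linarith+
    then show ?thesis using less pos assms(4) by (simp add: sector_depth_def 1)
  next
    case 2
    have "n \<notin> inner_sector w 1 3" "n' \<notin> inner_sector w 1 3" "n \<notin> inner_sector w 3 2" "n' \<notin> inner_sector w 3 2"
      using inner n' sum unfolding inner_sector_def mem_Collect_eq 2 by linarith+
    then show ?thesis using less pos assms(4) by (simp add: sector_depth_def 2)
  next
    case 3
    have "n \<notin> inner_sector w 2 1" "n' \<notin> inner_sector w 2 1" "n \<notin> inner_sector w 1 3" "n' \<notin> inner_sector w 1 3"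
      using inner n' sum unfolding inner_sector_def mem_Collect_eq 3 by linarith+
    then show ?thesis using less pos assms(4) by (simp add: sector_depth_def 3)
  qed
qed

section \<open>Elementary construction steps for generic data\<close>

context
  fixes S :: "(int ^ 3) set" and q :: "int ^ 3 \<Rightarrow> mpoint"
  assumes gen: "generic_data S q"
begin

private abbreviation "P \<equiv> constructed_point S q"
private abbreviation "K \<equiv> constructed_circle S q"

lemma neighbours_distinct:
  assumes "P m x" "P n y" "m \<noteq> n" "lattice_adj m v" "lattice_adj n v"
  shows "x \<noteq> y"
  using gen assms unfolding generic_data_def nearby_def by blast

lemma neighbour_circles_distinct:
  assumes "K v C" "K v' C'" "v \<noteq> v'" "lattice_adj v n" "lattice_adj v' n"
  shows "C \<noteq> C'"
  using gen assms unfolding generic_data_def nearby_def by blast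

lemma circle_at:
  assumes "P n1 x1" "P n2 x2" "P n3 x3" "lattice_adj n1 v" "lattice_adj n2 v" "lattice_adj n3 v"
    "distinct [n1, n2, n3]"
  obtains C where "K v C" "C \<in> mcircles" "x1 \<in> C" "x2 \<in> C" "x3 \<in> C"
proof -
  have "distinct [x1, x2, x3]" using assms neighbours_distinct by auto
  moreover from this obtain C where "C \<in> mcircles" "{x1, x2, x3} \<subseteq> C"
    using mcircle_exists by blast
  ultimately show thesis using assms that circle_through[of n1 v n2 n3] by auto
qed

text \<open>Genericity makes the two circles distinct, so that their intersection is a pair and the
  construction rule applies.\<close>

lemma second_point_at:
  assumes "K v C" "K v' C'" "P m y" "y \<in> C" "y \<in> C'" "v \<noteq> v'" "m \<noteq> n"
    "lattice_adj m v" "lattice_adj m v'" "lattice_adj n v" "lattice_adj n v'"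
  obtains x where "P n x" "x \<in> C" "x \<in> C'"
proof -
  have "C \<noteq> C'" using assms neighbour_circles_distinct[of v C v' C' m] lattice_adj_commute by blast
  then obtain x where "C \<inter> C' = {y, x}"
    using mcircle_Int_mcircle[of C C' y] assms constructed_circle_mcircles by blast
  moreover from this have "P n x"
    using assms second_intersection[of v v' m n] by blast
  ultimately show thesis using that by blast
qed

lemma neighbours_distinct4:
  assumes "P n1 x1" "P n2 x2" "P n3 x3" "P n4 x4" "lattice_adj n1 v" "lattice_adj n2 v"
    "lattice_adj n3 v" "lattice_adj n4 v" "distinct [n1, n2, n3, n4]"
  shows "distinct [x1, x2, x3, x4]"
  using assms neighbours_distinct by auto

lemma cocircular_neighbours:
  assumes "C \<in> mcircles" "x1 \<in> C" "x2 \<in> C" "x3 \<in> C" "x4 \<in> C"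
    "P n1 x1" "P n2 x2" "P n3 x3" "P n4 x4" "lattice_adj n1 v" "lattice_adj n2 v"
    "lattice_adj n3 v" "lattice_adj n4 v" "distinct [n1, n2, n3, n4]"
  shows "cocircular [x1, x2, x3, x4]"
  unfolding cocircular_def using assms neighbours_distinct by auto

text \<open>Only the corner \<open>pos d u 0 0 2\<close> lacks its point. The circles at the other
  two corners produce the common point \<open>x\<close> at \<open>u\<close>, and \<open>x\<close>
  with two known points determines the circle \<open>C3\<close> on which the missing point must
  lie.\<close>

lemma triangle_completion:
  assumes d: "frame d"
    and P: "P (pos d u 1 1 0) y110" "P (pos d u 2 0 0) y200" "P (pos d u 0 2 0) y020"
      "P (pos d u 1 0 1) y101" "P (pos d u 0 1 1) y011"
  obtains x C1 C2 C3 where "P u x" "C1 \<in> mcircles" "{x, y200, y110, y101} \<subseteq> C1"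
    "C2 \<in> mcircles" "{x, y020, y110, y011} \<subseteq> C2"
    "K (pos d u 0 0 1) C3" "{x, y101, y011} \<subseteq> C3"
proof -
  note s = pos_eq_iff[OF d]
  note a = lattice_adj_pos[OF d]
  obtain C1 where C1: "K (pos d u 1 0 0) C1" "C1 \<in> mcircles" "y200 \<in> C1" "y110 \<in> C1" "y101 \<in> C1"
    by (rule circle_at[OF P(2) P(1) P(4), of "pos d u 1 0 0"]) (auto intro!: a simp: s)
  obtain C2 where C2: "K (pos d u 0 1 0) C2" "C2 \<in> mcircles" "y020 \<in> C2" "y110 \<in> C2" "y011 \<in> C2"
    by (rule circle_at[OF P(3) P(1) P(5), of "pos d u 0 1 0"]) (auto intro!: a simp: s)
  obtain x where x: "P (pos d u 0 0 0) x" "x \<in> C1" "x \<in> C2"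
    by (rule second_point_at[OF C1(1) C2(1) P(1) C1(4) C2(4), of "pos d u 0 0 0"])
      (auto intro!: a simp: s)
  obtain C3 where C3: "K (pos d u 0 0 1) C3" "C3 \<in> mcircles" "x \<in> C3" "y101 \<in> C3" "y011 \<in> C3"
    by (rule circle_at[OF x(1) P(4) P(5), of "pos d u 0 0 1"]) (auto intro!: a simp: s)
  show thesis using that[of x C1 C2 C3] C1 C2 C3 x by (simp add: pos_0)
qed

section \<open>Layers, and the passage from one layer to the next\<close>

text \<open>The common point has to be a constructed one, so that it can serve as the point of the
  next layer and genericity applies to it. Equal indices \<open>j\<close>, \<open>l\<close> give the
  corners of the triangle.\<close>

definition concurrent_at :: "int \<Rightarrow> (int ^ 3 \<Rightarrow> mpoint) \<Rightarrow> int ^ 3 \<Rightarrow> bool" where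
  "concurrent_at s p u \<longleftrightarrow> (\<exists>x. P u x \<and>
     (\<forall>j. \<exists>C\<in>mcircles. x \<in> C \<and> (\<forall>l. p (u + s *s evec j + s *s evec l) \<in> C)))"

text \<open>The sign \<open>s\<close> tells whether the next layer lies in the direction \<open>(1, 1, 1)\<close> or in the
  opposite one.\<close>

definition layer :: "int \<Rightarrow> int \<Rightarrow> (int ^ 3 \<Rightarrow> mpoint) \<Rightarrow> bool" where
  "layer s k p \<longleftrightarrow> (\<forall>n\<in>A2 (s * k). P n (p n)) \<and> (\<forall>u\<in>A2 (s * (k + 2)). concurrent_at (- s) p u)
     \<and> (\<forall>u\<in>A2 (s * (k - 2)). concurrent_at s p u)"

lemma A2_shift: "n + s *s evec l \<in> A2 k \<longleftrightarrow> n \<in> A2 (k - s)"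
  using exhaust_3[of l] by (auto simp: A2_def axis_def)

lemma layer_step:
  assumes s: "s = 1 \<or> s = -1" and p: "layer s k p"
  shows "\<exists>p'. layer s (k + 2) p' \<and>
    (\<forall>v\<in>A2 (s * (k + 1)). \<exists>C\<in>mcircles. \<forall>l. p (v - s *s evec l) \<in> C \<and> p' (v + s *s evec l) \<in> C)"
proof -
  have Pp: "P n (p n)" if "n \<in> A2 (s * k)" for n
    using p that by (auto simp: layer_def)
  have "\<forall>u\<in>A2 (s * (k + 2)). \<exists>x. P u x \<and>
     (\<forall>j. \<exists>C\<in>mcircles. x \<in> C \<and> (\<forall>l. p (u - s *s evec j - s *s evec l) \<in> C))"
    using p by (simp add: layer_def concurrent_at_def minus_scale_vec)
  then obtain p' where Pp': "P u (p' u)" and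
    c: "\<exists>C\<in>mcircles. p' u \<in> C \<and> (\<forall>l. p (u - s *s evec j - s *s evec l) \<in> C)"
    if "u \<in> A2 (s * (k + 2))" for u j
    by (metis (no_types, lifting))
  have link: "\<exists>C\<in>mcircles. \<forall>l. p (v - s *s evec l) \<in> C \<and> p' (v + s *s evec l) \<in> C"
    if v: "v \<in> A2 (s * (k + 1))" for v
  proof -
    have v': "v + s *s evec l \<in> A2 (s * (k + 2))" for l
      using v by (simp add: A2_shift algebra_simps)
    have "\<exists>C\<in>mcircles. p' (v + s *s evec j) \<in> C \<and> (\<forall>l. p (v - s *s evec l) \<in> C)" for j
      using c[OF v'[of j], of j] by simp
    then obtain C where C: "C j \<in> mcircles" "p' (v + s *s evec j) \<in> C j" "p (v - s *s evec l) \<in> C j"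
      for j l
      by metis
    have vm: "P (v - s *s evec l) (p (v - s *s evec l))" for l
      using v A2_shift[of "v - s *s evec l" s l "s * (k + 1)"]
      by (intro Pp) (simp add: algebra_simps)
    have adj: "lattice_adj (v - s *s evec l) v" for l
      using s by (intro lattice_adj_signed[of s _ _ l]) auto
    have ne: "v - s *s evec j \<noteq> v - s *s evec l" if "j \<noteq> l" for j l
      using s that by (auto simp: vec_eq_iff axis_def)
    \<comment> \<open>Three old points already determine a circle, so the circles found for the
      different \<open>j\<close> coincide.\<close>
    have "distinct [p (v - s *s evec 1), p (v - s *s evec 2), p (v - s *s evec 3)]"
      using neighbours_distinct[OF vm vm ne adj adj] by simp
    then have "C j = C 1" for j
      using C by (intro mcircle_unique) auto
    then show ?thesis using C by metis
  qed
  have up: "concurrent_at (- s) p' U" if U: "U \<in> A2 (s * (k + 4))" for U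
  proof -
    \<comment> \<open>Coordinates run from \<open>U\<close> back towards the old layer: sum 2 is the
      new layer, sum 3 the linking circles, sum 4 the old layer, and \<open>V 2 2 2\<close> is the
      centre of an old triangle on the far side.\<close>
    define d where "d = (\<lambda>l::3. (- s) *s evec l)"
    have d: "frame d"
      unfolding frame_def by (intro exI[of _ "- s"] exI[of _ id]) (use s in \<open>auto simp: d_def\<close>)
    define V where "V = pos d U"
    note eq = pos_eq_iff[OF d, of U, folded V_def]
    note adj = lattice_adj_pos[OF d, of _ _ _ _ _ _ U, folded V_def]
    have V: "V i j l \<in> A2 (s * (k + 4 - i - j - l))" for i j l
      using U by (simp add: V_def pos_def d_def A2_def axis_def algebra_simps)
    have level2: "P (V i j l) (p' (V i j l))" if "i + j + l = 2" for i j l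
    proof -
      have "k + 4 - i - j - l = k + 2" using that by simp
      with V[of i j l] show ?thesis by (metis Pp')
    qed
    have level4: "P (V i j l) (p (V i j l))" if "i + j + l = 4" for i j l
    proof -
      have "k + 4 - i - j - l = k" using that by simp
      with V[of i j l] show ?thesis by (metis Pp)
    qed
    have shift: "V i j l - s *s evec 1 = V (i + 1) j l" "V i j l - s *s evec 2 = V i (j + 1) l"
      "V i j l - s *s evec 3 = V i j (l + 1)" "V i j l + s *s evec 1 = V (i - 1) j l"
      "V i j l + s *s evec 2 = V i (j - 1) l" "V i j l + s *s evec 3 = V i j (l - 1)" for i j l
      by (auto simp: V_def pos_def d_def vec_eq_iff algebra_simps)
    have side: "cocircular [p' (V i1 j1 l1), p' (V i2 j2 l2), p (V i3 j3 l3), p (V i4 j4 l4)]"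
      if sum: "i + j + l = 3"
        and m: "(i1, j1, l1) \<in> {(i - 1, j, l), (i, j - 1, l), (i, j, l - 1)}"
          "(i2, j2, l2) \<in> {(i - 1, j, l), (i, j - 1, l), (i, j, l - 1)}"
          "(i3, j3, l3) \<in> {(i + 1, j, l), (i, j + 1, l), (i, j, l + 1)}"
          "(i4, j4, l4) \<in> {(i + 1, j, l), (i, j + 1, l), (i, j, l + 1)}"
        and ne: "(i1, j1, l1) \<noteq> (i2, j2, l2)" "(i3, j3, l3) \<noteq> (i4, j4, l4)"
      for i j l i1 j1 l1 i2 j2 l2 i3 j3 l3 i4 j4 l4
    proof -
      have "k + 4 - i - j - l = k + 1" using sum by simp
      then have "V i j l \<in> A2 (s * (k + 1))" using V[of i j l] by metis
      from link[OF this] obtain C where C: "C \<in> mcircles"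
        "\<forall>l'. p (V i j l - s *s evec l') \<in> C \<and> p' (V i j l + s *s evec l') \<in> C"
        by blast
      have C': "p' (V a b c) \<in> C" if "(a, b, c) \<in> {(i - 1, j, l), (i, j - 1, l), (i, j, l - 1)}" for a b c
        using C(2) that unfolding forall_3 shift by auto
      have C'': "p (V a b c) \<in> C" if "(a, b, c) \<in> {(i + 1, j, l), (i, j + 1, l), (i, j, l + 1)}" for a b c
        using C(2) that unfolding forall_3 shift by auto
      have s2: "a + b + c = 2" if "(a, b, c) \<in> {(i - 1, j, l), (i, j - 1, l), (i, j, l - 1)}" for a b c
        using that sum by auto
      have s4: "a + b + c = 4" if "(a, b, c) \<in> {(i + 1, j, l), (i, j + 1, l), (i, j, l + 1)}" for a b c
        using that sum by auto
      note sum' = s2[OF m(1)] s2[OF m(2)] s4[OF m(3)] s4[OF m(4)]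
      have ne': "V a b c \<noteq> V a' b' c'" if "a + b + c = 2" "a' + b' + c' = 4" for a b c a' b' c'
        using that by (auto simp: eq)
      have adj': "lattice_adj (V a b c) (V i j l)"
        if "(a, b, c) \<in> {(i - 1, j, l), (i, j - 1, l), (i, j, l - 1)}
          \<or> (a, b, c) \<in> {(i + 1, j, l), (i, j + 1, l), (i, j, l + 1)}" for a b c
        using that by (intro adj) (elim disjE insertE emptyE; simp)
      have "distinct [V i1 j1 l1, V i2 j2 l2, V i3 j3 l3, V i4 j4 l4]"
        using ne'[OF sum'(1,3)] ne'[OF sum'(1,4)] ne'[OF sum'(2,3)] ne'[OF sum'(2,4)] ne
        by (simp add: eq)
      with C'[OF m(1)] C'[OF m(2)] C''[OF m(3)] C''[OF m(4)] level2[OF sum'(1)] level2[OF sum'(2)]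
        level4[OF sum'(3)] level4[OF sum'(4)] adj'[OF disjI1[OF m(1)]] adj'[OF disjI1[OF m(2)]]
        adj'[OF disjI2[OF m(3)]] adj'[OF disjI2[OF m(4)]]
      show ?thesis by (intro cocircular_neighbours[OF C(1)])
    qed
    obtain y where y: "P (V 2 2 2) y"
      "\<exists>C\<in>mcircles. y \<in> C \<and> (\<forall>l. p (V 2 2 2 + s *s evec j + s *s evec l) \<in> C)" for j
      using p V[of 2 2 2] unfolding layer_def concurrent_at_def by (auto simp: algebra_simps)
    \<comment> \<open>The new triangle has corners \<open>a\<close> and midpoints \<open>b\<close>;
      the old triangle around \<open>V 2 2 2\<close> has corners \<open>m\<close> and midpoints
      \<open>n\<close>.\<close>
    define a1 a2 a3 where a: "a1 = p' (V 2 0 0)" "a2 = p' (V 0 2 0)" "a3 = p' (V 0 0 2)"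
    define b1 b2 b3 where b: "b1 = p' (V 0 1 1)" "b2 = p' (V 1 0 1)" "b3 = p' (V 1 1 0)"
    define m1 m2 m3 where m: "m1 = p (V 0 2 2)" "m2 = p (V 2 0 2)" "m3 = p (V 2 2 0)"
    define n1 n2 n3 where n: "n1 = p (V 2 1 1)" "n2 = p (V 1 2 1)" "n3 = p (V 1 1 2)"
    have Pa: "P (V 2 0 0) a1" "P (V 0 2 0) a2" "P (V 0 0 2) a3"
      and Pb: "P (V 0 1 1) b1" "P (V 1 0 1) b2" "P (V 1 1 0) b3"
      and Pm: "P (V 0 2 2) m1" "P (V 2 0 2) m2" "P (V 2 2 0) m3"
      and Pn: "P (V 2 1 1) n1" "P (V 1 2 1) n2" "P (V 1 1 2) n3"
      unfolding a b m n by (simp_all add: level2 level4)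
    have c1: "cocircular [a1, b3, m3, n1]" unfolding a b m n by (rule side[of 2 1 0]) simp_all
    have c2: "cocircular [a2, b3, m3, n2]" unfolding a b m n by (rule side[of 1 2 0]) simp_all
    have c3: "cocircular [a2, b1, m1, n2]" unfolding a b m n by (rule side[of 0 2 1]) simp_all
    have c4: "cocircular [a3, b1, m1, n3]" unfolding a b m n by (rule side[of 0 1 2]) simp_all
    have c5: "cocircular [a3, b2, m2, n3]" unfolding a b m n by (rule side[of 1 0 2]) simp_all
    have c6: "cocircular [a1, b2, m2, n1]" unfolding a b m n by (rule side[of 2 0 1]) simp_all
    obtain E where E: "E j \<in> mcircles" "y \<in> E j" and
      E': "\<forall>l. p (V 2 2 2 + s *s evec j + s *s evec l) \<in> E j" for j
      using y(2) by metis
    have E1: "m1 \<in> E 1" "n2 \<in> E 1" "n3 \<in> E 1"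
      using E'[of 1] unfolding forall_3 shift m n by simp_all
    have E2: "m2 \<in> E 2" "n3 \<in> E 2" "n1 \<in> E 2"
      using E'[of 2] unfolding forall_3 shift m n by simp_all
    have E3: "m3 \<in> E 3" "n1 \<in> E 3" "n2 \<in> E 3"
      using E'[of 3] unfolding forall_3 shift m n by simp_all
    have e1: "cocircular [m1, n2, y, n3]"
      by (rule cocircular_neighbours[OF E(1)[of 1] _ _ _ _ Pm(1) Pn(2) y(1) Pn(3), where v = "V 1 2 2"])
        (auto intro!: adj simp: eq E E1)
    have e2: "cocircular [m2, n3, y, n1]"
      by (rule cocircular_neighbours[OF E(1)[of 2] _ _ _ _ Pm(2) Pn(3) y(1) Pn(1), where v = "V 2 1 2"])
        (auto intro!: adj simp: eq E E2)
    have e3: "cocircular [m3, n1, y, n2]"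
      by (rule cocircular_neighbours[OF E(1)[of 3] _ _ _ _ Pm(3) Pn(1) y(1) Pn(2), where v = "V 2 2 1"])
        (auto intro!: adj simp: eq E E3)
    obtain D1 where D1: "K (V 1 0 0) D1" "D1 \<in> mcircles" "a1 \<in> D1" "b3 \<in> D1" "b2 \<in> D1"
      by (rule circle_at[OF Pa(1) Pb(3) Pb(2), of "V 1 0 0"]) (auto intro!: adj simp: eq)
    obtain D2 where D2: "K (V 0 1 0) D2" "D2 \<in> mcircles" "a2 \<in> D2" "b1 \<in> D2" "b3 \<in> D2"
      by (rule circle_at[OF Pa(2) Pb(1) Pb(3), of "V 0 1 0"]) (auto intro!: adj simp: eq)
    obtain D3 where D3: "K (V 0 0 1) D3" "D3 \<in> mcircles" "a3 \<in> D3" "b2 \<in> D3" "b1 \<in> D3"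
      by (rule circle_at[OF Pa(3) Pb(2) Pb(1), of "V 0 0 1"]) (auto intro!: adj simp: eq)
    \<comment> \<open>Two of the new circles define \<open>x\<close>; that it lies on the third is
      the content of \<open>concurrent_circles\<close>.\<close>
    obtain x where x: "P (V 0 0 0) x" "x \<in> D1" "x \<in> D2"
      by (rule second_point_at[OF D1(1) D2(1) Pb(3) D1(4) D2(5), of "V 0 0 0"])
        (auto intro!: adj simp: eq)
    have d1: "cocircular [a1, b3, x, b2]"
      by (rule cocircular_neighbours[OF D1(2) _ _ _ _ Pa(1) Pb(3) x(1) Pb(2), where v = "V 1 0 0"])
        (auto intro!: adj simp: eq x D1)
    have d2: "cocircular [a2, b1, x, b3]"
      by (rule cocircular_neighbours[OF D2(2) _ _ _ _ Pa(2) Pb(1) x(1) Pb(3), where v = "V 0 1 0"])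
        (auto intro!: adj simp: eq x D2)
    have d3: "distinct [a3, b2, x, b1]"
      by (rule neighbours_distinct4[OF Pa(3) Pb(2) x(1) Pb(1), of "V 0 0 1"])
        (auto intro!: adj simp: eq)
    have "x \<in> D3"
      using concurrent_circles[OF c1 c2 c3 c4 c5 c6 e1 e2 e3 d1 d2 D3(2) _ d3] D3 by simp
    with x D1 D2 D3
    have D: "\<exists>C\<in>mcircles. x \<in> C \<and> a1 \<in> C \<and> b3 \<in> C \<and> b2 \<in> C"
      "\<exists>C\<in>mcircles. x \<in> C \<and> b3 \<in> C \<and> a2 \<in> C \<and> b1 \<in> C"
      "\<exists>C\<in>mcircles. x \<in> C \<and> b2 \<in> C \<and> b1 \<in> C \<and> a3 \<in> C"
      by - ((rule bexI[of _ D1] bexI[of _ D2] bexI[of _ D3]; simp; fail)+)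
    have U0: "U = V 0 0 0" by (simp add: V_def pos_0)
    show ?thesis
      unfolding concurrent_at_def forall_3 minus_scale_vec add_uminus_conv_diff U0 shift
      by (rule exI[of _ x]) (use x(1) D in \<open>simp add: a b\<close>)
  qed
  \<comment> \<open>Here the common point is the old point \<open>p u\<close>, and the circles are
    the linking circles around \<open>u\<close>.\<close>
  have down: "concurrent_at s p' u" if u: "u \<in> A2 (s * k)" for u
  proof -
    have "\<exists>C\<in>mcircles. p u \<in> C \<and> (\<forall>l. p' (u + s *s evec j + s *s evec l) \<in> C)" for j
    proof -
      have "u + s *s evec j \<in> A2 (s * (k + 1))"
        using u by (simp add: A2_shift algebra_simps)
      from link[OF this] obtain C where C: "C \<in> mcircles"
        "\<forall>l. p (u + s *s evec j - s *s evec l) \<in> C \<and> p' (u + s *s evec j + s *s evec l) \<in> C"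
        by blast
      then show ?thesis by (metis add_diff_cancel_right')
    qed
    then show ?thesis using Pp[OF u] unfolding concurrent_at_def by blast
  qed
  have "layer s (k + 2) p'"
    using Pp' up down by (simp add: layer_def add.assoc)
  then show ?thesis using link by blast
qed

section \<open>Filling the sectors of the base layer\<close>

lemma concurrent_at_cong:
  assumes "\<And>j l. p (u + s *s evec j + s *s evec l) = p' (u + s *s evec j + s *s evec l)"
  shows "concurrent_at s p u \<longleftrightarrow> concurrent_at s p' u"
  by (simp add: concurrent_at_def assms)

lemma forall_3_inj:
  fixes \<pi> :: "3 \<Rightarrow> 3"
  assumes "inj \<pi>"
  shows "(\<forall>j. Q j) \<longleftrightarrow> Q (\<pi> 1) \<and> Q (\<pi> 2) \<and> Q (\<pi> 3)"
proof -
  have "surj \<pi>" using assms by (simp add: finite_UNIV_inj_surj)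
  then have "(\<forall>j. Q j) \<longleftrightarrow> (\<forall>i. Q (\<pi> i))" by (metis surjD)
  then show ?thesis by (simp add: forall_3)
qed

text \<open>Both triangles lack only the point at \<open>n\<close>. Each forces a circle through it,
  and these circles already meet in the known point at \<open>pos e n (-1) 0 1\<close>, so
  \<open>X\<close> is their second intersection.\<close>

lemma triangle_corner:
  fixes \<pi> :: "3 \<Rightarrow> 3"
  assumes \<pi>: "inj \<pi>" and e: "e = (\<lambda>l. evec (\<pi> l))"
    and P: "\<And>i j k. \<lbrakk>-2 \<le> i; i \<le> 0; 0 \<le> k; k \<le> 2; i + j + k = 0; (i, k) \<noteq> (0, 0)\<rbrakk>
      \<Longrightarrow> P (pos e n i j k) (f (pos e n i j k))"
  obtains X where "P n X" "concurrent_at (-1) (f(n := X)) (n + 2 *s e 3)" "concurrent_at 1 (f(n := X)) (n - 2 *s e 1)"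
proof -
  define V where "V = pos e n"
  have e': "frame e"
    unfolding frame_def e by (intro exI[of _ 1] exI[of _ \<pi>]) (use \<pi> in simp)
  note eq = pos_eq_iff[OF e', of n, folded V_def]
  note adj = lattice_adj_pos[OF e', of _ _ _ _ _ _ n, folded V_def]
  have shift: "V i j l - evec (\<pi> 1) = V (i - 1) j l" "V i j l - evec (\<pi> 2) = V i (j - 1) l"
    "V i j l - evec (\<pi> 3) = V i j (l - 1)" "V i j l + evec (\<pi> 1) = V (i + 1) j l"
    "V i j l + evec (\<pi> 2) = V i (j + 1) l" "V i j l + evec (\<pi> 3) = V i j (l + 1)" for i j l
    by (auto simp: V_def pos_def e vec_eq_iff algebra_simps)
  define d where "d = (\<lambda>l. (-1) *s e l)"
  have d: "frame d"
    unfolding frame_def d_def e by (intro exI[of _ "-1"] exI[of _ \<pi>]) (use \<pi> in simp)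
  have Vd: "pos d (V 0 0 2) i j k = V (- i) (- j) (2 - k)" for i j k
    by (simp add: V_def pos_def d_def vec_eq_iff algebra_simps)
  \<comment> \<open>The cyclic shift puts the free corner of the second triangle in third place, as
    \<open>triangle_completion\<close> expects.\<close>
  define \<sigma> :: "3 \<Rightarrow> 3" where "\<sigma> = (\<lambda>l. if l = 1 then \<pi> 2 else if l = 2 then \<pi> 3 else \<pi> 1)"
  have "inj \<sigma>"
    using \<pi> unfolding inj_def forall_3 \<sigma>_def by simp
  define d' where "d' = (\<lambda>l. evec (\<sigma> l))"
  have d': "frame d'"
    unfolding frame_def d'_def by (intro exI[of _ 1] exI[of _ \<sigma>]) (use \<open>inj \<sigma>\<close> in simp)
  have Vd': "pos d' (V (-2) 0 0) i j k = V (k - 2) i j" for i j k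
    by (simp add: V_def pos_def d'_def \<sigma>_def e vec_eq_iff algebra_simps)
  note P = P[folded V_def]
  obtain x C1 C2 C3 where x: "P (V 0 0 2) x"
    and C: "C1 \<in> mcircles" "{x, f (V (-2) 0 2), f (V (-1) (-1) 2), f (V (-1) 0 1)} \<subseteq> C1"
      "C2 \<in> mcircles" "{x, f (V 0 (-2) 2), f (V (-1) (-1) 2), f (V 0 (-1) 1)} \<subseteq> C2"
      "K (V 0 0 1) C3" "{x, f (V (-1) 0 1), f (V 0 (-1) 1)} \<subseteq> C3"
    by (rule triangle_completion[OF d, of "V 0 0 2" "f (V (-1) (-1) 2)" "f (V (-2) 0 2)"
          "f (V 0 (-2) 2)" "f (V (-1) 0 1)" "f (V 0 (-1) 1)", unfolded Vd]) (simp_all add: P)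
  obtain y D1 D2 D3 where y: "P (V (-2) 0 0) y"
    and D: "D1 \<in> mcircles" "{y, f (V (-2) 2 0), f (V (-2) 1 1), f (V (-1) 1 0)} \<subseteq> D1"
      "D2 \<in> mcircles" "{y, f (V (-2) 0 2), f (V (-2) 1 1), f (V (-1) 0 1)} \<subseteq> D2"
      "K (V (-1) 0 0) D3" "{y, f (V (-1) 1 0), f (V (-1) 0 1)} \<subseteq> D3"
    by (rule triangle_completion[OF d', of "V (-2) 0 0" "f (V (-2) 1 1)" "f (V (-2) 2 0)"
          "f (V (-2) 0 2)" "f (V (-1) 1 0)" "f (V (-1) 0 1)", unfolded Vd']) (simp_all add: P)
  obtain X where X: "P (V 0 0 0) X" "X \<in> C3" "X \<in> D3"
  proof (rule second_point_at[OF C(5) D(5), of "V (-1) 0 1" "f (V (-1) 0 1)" "V 0 0 0"])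
    show "P (V (-1) 0 1) (f (V (-1) 0 1))" by (rule P) simp_all
    show "f (V (-1) 0 1) \<in> C3" "f (V (-1) 0 1) \<in> D3" using C(6) D(6) by simp_all
    show "V 0 0 1 \<noteq> V (-1) 0 0" "V (-1) 0 1 \<noteq> V 0 0 0" by (simp_all add: eq)
    show "lattice_adj (V (-1) 0 1) (V 0 0 1)" "lattice_adj (V (-1) 0 1) (V (-1) 0 0)"
      "lattice_adj (V 0 0 0) (V 0 0 1)" "lattice_adj (V 0 0 0) (V (-1) 0 0)"
      by (rule adj; simp)+
  qed
  have n: "n = V 0 0 0" by (simp add: V_def pos_0)
  have u: "V 0 0 0 + 2 *s e 3 = V 0 0 2" "V 0 0 0 - 2 *s e 1 = V (-2) 0 0"
    by (simp_all add: V_def pos_def vec_eq_iff)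
  have up: "\<exists>C\<in>mcircles. x \<in> C \<and> f (V (-2) 0 2) \<in> C \<and> f (V (-1) (-1) 2) \<in> C \<and> f (V (-1) 0 1) \<in> C"
    "\<exists>C\<in>mcircles. x \<in> C \<and> f (V (-1) (-1) 2) \<in> C \<and> f (V 0 (-2) 2) \<in> C \<and> f (V 0 (-1) 1) \<in> C"
    "\<exists>C\<in>mcircles. x \<in> C \<and> f (V (-1) 0 1) \<in> C \<and> f (V 0 (-1) 1) \<in> C \<and> X \<in> C"
    by (rule bexI[of _ C1] bexI[of _ C2] bexI[of _ C3];
        use C(1-4,6) X(2) constructed_circle_mcircles[OF C(5)] in \<open>simp; fail\<close>)+
  have 1: "concurrent_at (-1) (f(n := X)) (n + 2 *s e 3)"
    unfolding concurrent_at_def forall_3_inj[OF \<pi>] n u minus_scale_vec vector_smult_lid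
      add_uminus_conv_diff shift
    by (rule exI[of _ x]) (simp add: eq x up)
  have down: "\<exists>C\<in>mcircles. y \<in> C \<and> X \<in> C \<and> f (V (-1) 1 0) \<in> C \<and> f (V (-1) 0 1) \<in> C"
    "\<exists>C\<in>mcircles. y \<in> C \<and> f (V (-1) 1 0) \<in> C \<and> f (V (-2) 2 0) \<in> C \<and> f (V (-2) 1 1) \<in> C"
    "\<exists>C\<in>mcircles. y \<in> C \<and> f (V (-1) 0 1) \<in> C \<and> f (V (-2) 1 1) \<in> C \<and> f (V (-2) 0 2) \<in> C"
    by (rule bexI[of _ D1] bexI[of _ D2] bexI[of _ D3];
        use D(1-4,6) X(3) constructed_circle_mcircles[OF D(5)] in \<open>simp; fail\<close>)+
  have 2: "concurrent_at 1 (f(n := X)) (n - 2 *s e 1)"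
    unfolding concurrent_at_def forall_3_inj[OF \<pi>] n u vector_smult_lid shift
    by (rule exI[of _ y]) (simp add: eq y down)
  show thesis using that[OF _ 1 2] X(1) n by simp
qed

text \<open>Well-founded recursion on the depth fills the sectors. Each triangle condition is
  charged to its free corner; the central triangle has none and is supplied by the
  hypothesis.\<close>

lemma base_layer:
  assumes w: "w \<in> A2 (-1)" and S: "S = Sigma_star w"
    and u: "concurrent_at (-1) q (w + evec 1 + evec 2 + evec 3)"
  shows "\<exists>p. layer 1 0 p \<and> layer (-1) 0 p \<and> (\<forall>n\<in>S. p n = q n)"
proof -
  define T :: "(3 \<times> 3) set" where "T = {(1, 3), (2, 1), (3, 2)}"
  define tri where "tri a b f n \<longleftrightarrow> concurrent_at (-1) f (n + 2 *s evec b) \<and> concurrent_at 1 f (n - 2 *s evec a)"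
    for a b f n
  \<comment> \<open>The update \<open>f(n := X)\<close> lets the specification speak about the
    candidate value, while \<open>f\<close> is only consulted at points of smaller depth.\<close>
  define Q where "Q f n X \<longleftrightarrow> (n \<in> A2 0 \<longrightarrow> P n X
    \<and> (\<forall>(a, b)\<in>T. n \<in> inner_sector w a b \<longrightarrow> tri a b (f(n := X)) n) \<and> (n \<in> S \<longrightarrow> X = q n))" for f n X
  have tri_cong: "tri a b f n \<longleftrightarrow> tri a b g n"
    if ab: "(a, b) \<in> T" and n: "n \<in> A2 0" "n \<in> inner_sector w a b"
      and fg: "f n = g n" "\<And>n'. sector_depth w n' < sector_depth w n \<Longrightarrow> f n' = g n'" for a b f g n
  proof -
    have near: "f n' = g n'" if "n' \<in> A2 0" "n $ a - 2 \<le> n' $ a" "n' $ a \<le> n $ a"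
      "n $ b \<le> n' $ b" "n' $ b \<le> n $ b + 2" for n'
    proof (cases "n' = n")
      case False
      show ?thesis
        using ab False that n unfolding T_def by (intro fg(2) sector_depth_less[OF w]) auto
    qed (use fg(1) in simp)
    have e: "evec b $ a = 0" "evec a $ b = 0" "evec a $ a = 1" "evec b $ b = 1"
      using ab by (auto simp: T_def axis_def)
    have "f (n + 2 *s evec b + (-1) *s evec j + (-1) *s evec l)
        = g (n + 2 *s evec b + (-1) *s evec j + (-1) *s evec l)" for j l
    proof (rule near)
      let ?n = "n + 2 *s evec b + (-1) *s evec j + (-1) *s evec l"
      show "?n \<in> A2 0" using n(1) A2_evec_sum[of b] A2_evec_sum[of j] A2_evec_sum[of l]
        by (simp add: A2_def)
      show "n $ a - 2 \<le> ?n $ a" "?n $ a \<le> n $ a" "n $ b \<le> ?n $ b" "?n $ b \<le> n $ b + 2"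
        using evec_bounds[of j a] evec_bounds[of l a] evec_bounds[of j b] evec_bounds[of l b]
        by (simp_all add: e)
    qed
    moreover have "f (n - 2 *s evec a + 1 *s evec j + 1 *s evec l)
        = g (n - 2 *s evec a + 1 *s evec j + 1 *s evec l)" for j l
    proof (rule near)
      let ?n = "n - 2 *s evec a + 1 *s evec j + 1 *s evec l"
      show "?n \<in> A2 0" using n(1) A2_evec_sum[of a] A2_evec_sum[of j] A2_evec_sum[of l]
        by (simp add: A2_def)
      show "n $ a - 2 \<le> ?n $ a" "?n $ a \<le> n $ a" "n $ b \<le> ?n $ b" "?n $ b \<le> n $ b + 2"
        using evec_bounds[of j a] evec_bounds[of l a] evec_bounds[of j b] evec_bounds[of l b]
        by (simp_all add: e)
    qed
    ultimately show ?thesis unfolding tri_def by (intro conj_cong concurrent_at_cong)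
  qed
  have "\<exists>p. \<forall>n. Q p n (p n)"
  proof (rule dependent_wf_choice[where R = "inv_image less_than (sector_depth w)"])
    show "Q f n X = Q g n X"
      if "\<And>n'. (n', n) \<in> inv_image less_than (sector_depth w) \<Longrightarrow> f n' = g n'" for f g n X
    proof -
      have "tri a b (f(n := X)) n \<longleftrightarrow> tri a b (g(n := X)) n"
        if "(a, b) \<in> T" "n \<in> A2 0" "n \<in> inner_sector w a b" for a b
        using that \<open>\<And>n'. (n', n) \<in> inv_image less_than (sector_depth w) \<Longrightarrow> f n' = g n'\<close>
        by (intro tri_cong) auto
      then show ?thesis unfolding Q_def by blast
    qed
    show "\<exists>X. Q f n X" if *: "\<And>n'. (n', n) \<in> inv_image less_than (sector_depth w) \<Longrightarrow> Q f n' (f n')" for f n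
    proof (cases "n \<in> A2 0 \<and> n \<notin> S")
      case False
      then show ?thesis
        using Sigma_star_iff[OF w, of n] prescribed[of n S q] unfolding Q_def T_def S by auto
    next
      case True
      then obtain a b c where abc: "(a, b, c) \<in> {(1, 2, 3), (2 :: 3, 3 :: 3, 1 :: 3), (3, 1, 2)}"
        and inner: "n \<in> inner_sector w a c"
        using Sigma_star_iff[OF w, of n] S by blast
      have T: "(a, c) \<in> T" using abc by (auto simp: T_def)
      define \<pi> :: "3 \<Rightarrow> 3" where "\<pi> = (\<lambda>l. if l = 1 then a else if l = 2 then b else c)"
      have \<pi>: "inj \<pi>" using abc unfolding inj_def forall_3 \<pi>_def by auto
      define e where "e = (\<lambda>l. evec (\<pi> l))"
      obtain X where X: "P n X" "concurrent_at (-1) (f(n := X)) (n + 2 *s e 3)" "concurrent_at 1 (f(n := X)) (n - 2 *s e 1)"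
      proof (rule triangle_corner[OF \<pi> e_def])
        fix i j k :: int
        assume ijk: "-2 \<le> i" "i \<le> 0" "0 \<le> k" "k \<le> 2" "i + j + k = 0" "(i, k) \<noteq> (0, 0)"
        define n' where "n' = pos e n i j k"
        have "n' \<in> A2 0" "n' $ a = n $ a + i" "n' $ c = n $ c + k"
          using abc True ijk(5) unfolding n'_def pos_def e_def \<pi>_def A2_def by (auto simp: axis_def)
        moreover from this have "sector_depth w n' < sector_depth w n"
          using ijk True T inner unfolding T_def by (intro sector_depth_less[OF w _ _ inner]) auto
        ultimately show "P n' (f n')"
          using *[of n'] unfolding Q_def by simp
      qed
      have "tri a' b' (f(n := X)) n" if "(a', b') \<in> T" "n \<in> inner_sector w a' b'" for a' b'
        using inner_sector_disjoint[OF w _ inner that(2)] T that True X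
        unfolding tri_def T_def by (auto simp: e_def \<pi>_def)
      then show ?thesis using X(1) True unfolding Q_def by blast
    qed
  qed simp
  then obtain p where p: "\<And>n. Q p n (p n)" by blast
  have Pp: "P n (p n)" if "n \<in> A2 0" for n
    using p[of n] that unfolding Q_def by simp
  have tri: "tri a b p n" if "(a, b) \<in> T" "n \<in> inner_sector w a b" "n \<in> A2 0" for a b n
    using p[of n] that unfolding Q_def by auto
  have pq: "p n = q n" if "n \<in> S" for n
    using p[of n] that Sigma_star_subset_A2[OF w] unfolding Q_def S by auto
  have "concurrent_at (-1) p v" if v: "v \<in> A2 2" for v
  proof -
    have sum: "v $ 1 + v $ 2 + v $ 3 = w $ 1 + w $ 2 + w $ 3 + 3"
      using v w by (simp add: A2_def)
    have up: "concurrent_at (-1) p v" if "(a, b) \<in> T" "v $ a \<ge> w $ a + 2" "v $ b \<le> w $ b + 1" for a b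
    proof -
      have "v - 2 *s evec b \<in> A2 0" using v that by (auto simp: T_def A2_def axis_def)
      moreover have "v - 2 *s evec b \<in> inner_sector w a b"
        using that by (auto simp: T_def inner_sector_def axis_def)
      ultimately show ?thesis using tri[OF that(1)] unfolding tri_def by force
    qed
    \<comment> \<open>The relative coordinates sum to 3: either \<open>v - 2 *s evec b\<close> is a
      free corner in some sector, or all three equal 1 and \<open>v\<close> is the central
      vertex.\<close>
    consider "v $ 1 \<ge> w $ 1 + 2" "v $ 3 \<le> w $ 3 + 1" | "v $ 2 \<ge> w $ 2 + 2" "v $ 1 \<le> w $ 1 + 1"
      | "v $ 3 \<ge> w $ 3 + 2" "v $ 2 \<le> w $ 2 + 1"
      | "v $ 1 = w $ 1 + 1" "v $ 2 = w $ 2 + 1" "v $ 3 = w $ 3 + 1"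
      using sum by linarith
    then show ?thesis
    proof cases
      case 4
      then have v4: "v = w + evec 1 + evec 2 + evec 3"
        by (simp add: vec3_eq_iff axis_def)
      have "v + (-1) *s evec j + (-1) *s evec l \<in> S" for j l
        using central_in_Sigma_star[OF w, of j l] unfolding v4 S minus_scale_vec by simp
      then show ?thesis using u pq unfolding v4 by (subst concurrent_at_cong[where p' = q]) auto
    qed (use up[of 1 3] up[of 2 1] up[of 3 2] in \<open>auto simp: T_def\<close>)
  qed
  moreover have "concurrent_at 1 p v" if v: "v \<in> A2 (-2)" for v
  proof -
    have sum: "v $ 1 + v $ 2 + v $ 3 = w $ 1 + w $ 2 + w $ 3 - 1"
      using v w by (simp add: A2_def)
    have down: "concurrent_at 1 p v" if "(a, b) \<in> T" "v $ a \<ge> w $ a" "v $ b \<le> w $ b - 1" for a b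
    proof -
      have "v + 2 *s evec a \<in> A2 0" using v that by (auto simp: T_def A2_def axis_def)
      moreover have "v + 2 *s evec a \<in> inner_sector w a b"
        using that by (auto simp: T_def inner_sector_def axis_def)
      ultimately show ?thesis using tri[OF that(1)] unfolding tri_def by force
    qed
    \<comment> \<open>With relative sum -1 there is no exceptional triangle.\<close>
    consider "v $ 1 \<ge> w $ 1" "v $ 3 \<le> w $ 3 - 1" | "v $ 2 \<ge> w $ 2" "v $ 1 \<le> w $ 1 - 1"
      | "v $ 3 \<ge> w $ 3" "v $ 2 \<le> w $ 2 - 1"
      using sum by linarith
    then show ?thesis
      by cases (use down[of 1 3] down[of 2 1] down[of 3 2] in \<open>auto simp: T_def\<close>)
  qed
  ultimately have "layer 1 0 p \<and> layer (-1) 0 p"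
    using Pp unfolding layer_def by simp
  then show ?thesis using pq by blast
qed

section \<open>The prescribed central triangle\<close>

text \<open>The given \<open>x\<close> is merely some common point and might a priori be one of the
  prescribed midpoints. Two of these are distinct, so \<open>x\<close> differs from one of them and
  is the second intersection of the corresponding circles, hence constructed.\<close>

lemma central_triangle_concurrent:
  assumes w: "w \<in> A2 (-1)" and S: "S = Sigma_star w" and u: "u = w + evec 1 + evec 2 + evec 3"
    and C: "\<And>k. C k \<in> mcircles" "\<And>k l. q (u - evec k - evec l) \<in> C k" "\<And>k. x \<in> C k"
  shows "concurrent_at (-1) q u"
proof -
  have adj: "lattice_adj (v - evec l) v" for v l
    by (auto simp: lattice_adj_def intro!: exI[of _ l])
  have Pq: "P (u - evec k - evec l) (q (u - evec k - evec l))" for k l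
    using central_in_Sigma_star[OF w, of k l] by (intro prescribed) (simp add: S u)
  have ne: "v - evec k \<noteq> v - evec l" if "k \<noteq> l" for v k l
    using that by (auto simp: axis_eq_axis)
  have K: "K (u - evec k) (C k)" for k
  proof (rule circle_through[OF adj adj adj Pq Pq Pq])
    show "distinct [q (u - evec k - evec 1), q (u - evec k - evec 2), q (u - evec k - evec 3)]"
      using neighbours_distinct[OF Pq Pq ne adj adj] by simp
    show "{q (u - evec k - evec 1), q (u - evec k - evec 2), q (u - evec k - evec 3)} \<subseteq> C k"
      using C(2) by blast
  qed (rule C(1))
  have second: "P u x" if "k \<noteq> l" "x \<noteq> q (u - evec k - evec l)" for k l
  proof -
    define m y where "m = u - evec k - evec l" and "y = q m"
    have m: "m = u - evec l - evec k" by (simp add: m_def)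
    have y: "y \<in> C k" "y \<in> C l"
      using C(2)[of k l] C(2)[of l k] by (simp_all only: y_def m_def[symmetric] m[symmetric])
    have "C k \<noteq> C l"
      using neighbour_circles_distinct[OF K K ne[OF that(1)] adj adj] .
    then obtain z where z: "C k \<inter> C l = {y, z}"
      using mcircle_Int_mcircle[OF C(1) C(1) _ y] by blast
    have "x \<in> C k \<inter> C l" using C(3) by simp
    then have "x = z" using that(2) unfolding z y_def m_def by simp
    have "m \<noteq> u"
    proof
      assume "m = u"
      from arg_cong[OF this, of "\<lambda>n. n $ k"] have "u $ k - evec k $ k - evec l $ k = u $ k"
        by (simp only: m_def vector_minus_component)
      then show False using evec_bounds(1)[of l k] by simp
    qed
    have Km: "K (u - evec k) (C k)" "K (u - evec l) (C l)" "P m y"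
      using K Pq by (simp_all add: m_def y_def)
    have "lattice_adj m (u - evec k)" "lattice_adj m (u - evec l)"
      using adj[of "u - evec k" l] adj[of "u - evec l" k] by (simp_all only: m_def[symmetric] m[symmetric])
    moreover have "lattice_adj u (u - evec i)" for i
      by (auto simp: lattice_adj_def intro!: exI[of _ i])
    moreover have "C k \<inter> C l = {y, x}" unfolding z \<open>x = z\<close> ..
    ultimately show ?thesis
      by (intro second_intersection[OF ne[OF that(1)] \<open>m \<noteq> u\<close> _ _ _ _ Km])
  qed
  have "q (u - evec 1 - evec 2) \<noteq> q (u - evec 1 - evec 3)"
    using neighbours_distinct[OF Pq Pq ne adj adj] by simp
  then have "x \<noteq> q (u - evec 1 - evec 2) \<or> x \<noteq> q (u - evec 1 - evec 3)" by metis
  then have "P u x" by (elim disjE) (erule second[rotated], simp)+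
  moreover have "\<exists>D\<in>mcircles. x \<in> D \<and> (\<forall>l. q (u + (-1) *s evec j + (-1) *s evec l) \<in> D)" for j
    by (rule bexI[of _ "C j"]) (simp_all add: C minus_scale_vec)
  ultimately show ?thesis unfolding concurrent_at_def by blast
qed

section \<open>Stacking the layers in both directions\<close>

lemma layer_tower:
  assumes s: "s = 1 \<or> s = -1" and p0: "layer s 0 p0"
  obtains L :: "nat \<Rightarrow> int ^ 3 \<Rightarrow> mpoint" where "L 0 = p0" "\<And>m. layer s (2 * int m) (L m)"
    "\<And>m v. v \<in> A2 (s * (2 * int m + 1)) \<Longrightarrow>
      \<exists>C\<in>mcircles. \<forall>l. L m (v - s *s evec l) \<in> C \<and> L (Suc m) (v + s *s evec l) \<in> C"
proof -
  have "\<exists>L. \<forall>m. (layer s (2 * int m) (L m) \<and> (m = 0 \<longrightarrow> L m = p0)) \<and>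
    (\<forall>v \<in> A2 (s * (2 * int m + 1)).
      \<exists>C\<in>mcircles. \<forall>l. L m (v - s *s evec l) \<in> C \<and> L (Suc m) (v + s *s evec l) \<in> C)"
  proof (rule dependent_nat_choice)
    show "\<exists>p. layer s (2 * int 0) p \<and> (0 = 0 \<longrightarrow> p = p0)"
      using p0 by auto
    show "\<exists>p'. (layer s (2 * int (Suc m)) p' \<and> (Suc m = 0 \<longrightarrow> p' = p0)) \<and>
        (\<forall>v \<in> A2 (s * (2 * int m + 1)).
          \<exists>C\<in>mcircles. \<forall>l. p (v - s *s evec l) \<in> C \<and> p' (v + s *s evec l) \<in> C)"
      if "layer s (2 * int m) p \<and> (m = 0 \<longrightarrow> p = p0)" for p m
      using layer_step[OF s, of "2 * int m" p] that by (simp add: algebra_simps)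
  qed
  then show thesis using that by metis
qed

text \<open>The two towers agree on \<open>A2 0\<close>, where both start from \<open>p0\<close>.
  Every odd level lies between consecutive layers, so its circles are the linking circles.\<close>

lemma complex_from_base:
  assumes up: "layer 1 0 p0" and down: "layer (-1) 0 p0"
  obtains p where "\<And>n. n \<in> even_lattice \<Longrightarrow> P n (p n)" "\<And>n. n \<in> A2 0 \<Longrightarrow> p n = p0 n"
    "\<And>v. v \<in> odd_lattice \<Longrightarrow> \<exists>C\<in>mcircles. \<forall>n. lattice_adj n v \<longrightarrow> p n \<in> C"
proof -
  obtain L where L: "L 0 = p0" "\<And>m. layer 1 (2 * int m) (L m)"
    "\<And>m v. v \<in> A2 (1 * (2 * int m + 1)) \<Longrightarrow>
      \<exists>C\<in>mcircles. \<forall>l. L m (v - 1 *s evec l) \<in> C \<and> L (Suc m) (v + 1 *s evec l) \<in> C"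
    using layer_tower[OF _ up] by auto
  obtain L' where L': "L' 0 = p0" "\<And>m. layer (-1) (2 * int m) (L' m)"
    "\<And>m v. v \<in> A2 (-1 * (2 * int m + 1)) \<Longrightarrow>
      \<exists>C\<in>mcircles. \<forall>l. L' m (v - (-1) *s evec l) \<in> C \<and> L' (Suc m) (v + (-1) *s evec l) \<in> C"
    using layer_tower[OF _ down] by auto
  define p where "p n = (let t = n $ 1 + n $ 2 + n $ 3 in
    if t \<ge> 0 then L (nat (t div 2)) n else L' (nat (- t div 2)) n)" for n
  have pL: "p n = L m n" if "n \<in> A2 (2 * int m)" for n m
    using that by (simp add: p_def A2_def)
  have pL': "p n = L' m n" if "n \<in> A2 (- (2 * int m))" for n m
    using that L(1) L'(1) by (cases "m = 0") (simp_all add: p_def A2_def Let_def)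
  have levels: "(\<exists>m. k = 2 * int m) \<or> (\<exists>m. k = - (2 * int m))" if "even k" for k :: int
  proof -
    obtain j where "k = 2 * j" using \<open>even k\<close> by (rule evenE)
    then show ?thesis by (cases j rule: int_cases2) auto
  qed
  show thesis
  proof
    show "P n (p n)" if n: "n \<in> even_lattice" for n
    proof -
      define t where "t = n $ 1 + n $ 2 + n $ 3"
      then have "n \<in> A2 t" by (simp add: A2_def)
      moreover have "even t" using n by (simp add: even_lattice_def t_def)
      ultimately consider m where "n \<in> A2 (2 * int m)" | m where "n \<in> A2 (- (2 * int m))"
        using levels by blast
      then show ?thesis
      proof cases
        case 1
        then show ?thesis using L(2)[of m] pL[OF 1] by (simp add: layer_def)
      next
        case 2
        then show ?thesis using L'(2)[of m] pL'[OF 2] by (simp add: layer_def)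
      qed
    qed
    show "p n = p0 n" if "n \<in> A2 0" for n
      using pL[of n 0] that L(1) by simp
    show "\<exists>C\<in>mcircles. \<forall>n. lattice_adj n v \<longrightarrow> p n \<in> C" if v: "v \<in> odd_lattice" for v
    proof -
      define t where "t = v $ 1 + v $ 2 + v $ 3"
      have vt: "v \<in> A2 t" by (simp add: A2_def t_def)
      have pm: "v + evec l \<in> A2 (t + 1)" "v - evec l \<in> A2 (t - 1)" for l
        using A2_evec_sum[of l] by (simp_all add: A2_def t_def)
      have "odd t" using v by (simp add: odd_lattice_def t_def)
      have "\<exists>C\<in>mcircles. \<forall>l. p (v - evec l) \<in> C \<and> p (v + evec l) \<in> C"
      proof (cases "t \<ge> 0")
        case True
        define m where "m = nat (t div 2)"
        have "int m = t div 2" using True by (simp add: m_def)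
        then have m: "t = 2 * int m + 1" using \<open>odd t\<close> by presburger
        have "p (v - evec l) = L m (v - evec l)" "p (v + evec l) = L (Suc m) (v + evec l)" for l
          using pm[of l] m by (auto intro!: pL simp: algebra_simps)
        then show ?thesis using L(3)[of v m] vt m by simp
      next
        case False
        define m where "m = nat (- t div 2)"
        have "int m = - t div 2" using False by (simp add: m_def)
        then have m: "t = - (2 * int m + 1)" using \<open>odd t\<close> by presburger
        \<comment> \<open>Below the base \<open>v + evec l\<close> is the neighbour nearer to it, so
          the roles of the two signs are exchanged.\<close>
        have "p (v + evec l) = L' m (v + evec l)" "p (v - evec l) = L' (Suc m) (v - evec l)" for l
          using pm[of l] m by (auto intro!: pL' simp: algebra_simps)
        then show ?thesis using L'(3)[of v m] vt m by (auto simp: minus_scale_vec)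
      qed
      then obtain C where C: "C \<in> mcircles" "\<forall>l. p (v - evec l) \<in> C \<and> p (v + evec l) \<in> C"
        by blast
      moreover have "\<exists>l. n = v - evec l \<or> n = v + evec l" if "lattice_adj n v" for n
        using that by (auto simp: lattice_adj_def)
      ultimately show ?thesis by blast
    qed
  qed
qed

end

section \<open>Uniqueness and the final assembly\<close>

lemma lattice_adj_parity:
  assumes "lattice_adj m n"
  shows "m \<in> even_lattice \<longleftrightarrow> n \<in> odd_lattice"
proof -
  obtain k where "n = m + evec k \<or> m = n + evec k" using assms by (auto simp: lattice_adj_def)
  then have "(n $ 1 + n $ 2 + n $ 3) = (m $ 1 + m $ 2 + m $ 3) + 1
      \<or> (n $ 1 + n $ 2 + n $ 3) + 1 = (m $ 1 + m $ 2 + m $ 3)"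
    using A2_evec_sum[of k] by auto
  then show ?thesis unfolding even_lattice_def odd_lattice_def mem_Collect_eq by presburger
qed

text \<open>Induction over the construction: a complex extending the data must agree with every
  constructed object. Its genericity excludes the first intersection point \<open>y\<close> in the
  step for points.\<close>

lemma complex_eq_constructed:
  assumes pc: "point_circle_complex p c" and gen: "generic_complex p c"
    and S: "S \<subseteq> even_lattice" "\<forall>n\<in>S. p n = q n"
  shows "constructed_point S q n x \<Longrightarrow> n \<in> even_lattice \<and> p n = x"
    and "constructed_circle S q v C \<Longrightarrow> v \<in> odd_lattice \<and> c v = C"
proof (induction rule: constructed_point_constructed_circle.inducts)
  case (prescribed n)
  then show ?case using S by auto
next
  case (circle_through n1 v n2 n3 x1 x2 x3 C)
  then have v: "v \<in> odd_lattice" using lattice_adj_parity by blast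
  then have "c v \<in> mcircles" "{x1, x2, x3} \<subseteq> c v"
    using pc circle_through unfolding point_circle_complex_def by auto
  then have "c v = C" using circle_through mcircle_unique by blast
  with v show ?case by simp
next
  case (second_intersection v v' m n C C' y x)
  then have n: "n \<in> even_lattice" using lattice_adj_parity by blast
  then have "p n \<in> C \<inter> C'"
    using pc second_intersection unfolding point_circle_complex_def by auto
  moreover have "nearby m n" using second_intersection unfolding nearby_def by blast
  then have "p n \<noteq> y" using gen n second_intersection unfolding generic_complex_def by metis
  ultimately show ?case using n second_intersection by auto
qed

theorem theorem5p4:
  fixes w u :: "int ^ 3" and q :: "int ^ 3 \<Rightarrow> mpoint" and C :: "3 \<Rightarrow> mpoint set"
  assumes "w \<in> A2 (-1)"
    and "u = w + evec 1 + evec 2 + evec 3"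
    and "generic_data (Sigma_star w) q"
    and "\<And>k. C k \<in> mcircles"
    and "\<And>k l. q (u - evec k - evec l) \<in> C k"
    and "\<exists>x. \<forall>k. x \<in> C k"
  shows "\<exists>!(p, c). point_circle_complex p c \<and> generic_complex p c \<and>
                   (\<forall>n \<in> Sigma_star w. p n = q n)"
proof -
  let ?S = "Sigma_star w"
  note gen = assms(3)
  obtain x where x: "\<And>k. x \<in> C k" using assms(6) by blast
  have "concurrent_at ?S q (-1) q u"
    by (rule central_triangle_concurrent[OF gen assms(1) refl assms(2,4,5) x])
  then obtain p0 where p0: "layer ?S q 1 0 p0" "layer ?S q (-1) 0 p0" "\<forall>n\<in>?S. p0 n = q n"
    using base_layer[OF gen assms(1) refl] assms(2) by blast
  obtain p where p: "\<And>n. n \<in> even_lattice \<Longrightarrow> constructed_point ?S q n (p n)"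
      "\<And>n. n \<in> A2 0 \<Longrightarrow> p n = p0 n"
      "\<And>v. v \<in> odd_lattice \<Longrightarrow> \<exists>C\<in>mcircles. \<forall>n. lattice_adj n v \<longrightarrow> p n \<in> C"
    using complex_from_base[OF gen p0(1,2)] by metis
  then obtain c where c: "\<And>v. v \<in> odd_lattice \<Longrightarrow> c v \<in> mcircles"
      "\<And>v n. v \<in> odd_lattice \<Longrightarrow> lattice_adj n v \<Longrightarrow> p n \<in> c v"
    by metis
  have A2_even: "n \<in> even_lattice" if "n \<in> A2 0" for n
    using that unfolding A2_def even_lattice_def mem_Collect_eq by (simp only: even_zero)
  then have S_even: "?S \<subseteq> even_lattice" using Sigma_star_subset_A2[OF assms(1)] by blast
  have pq: "p n = q n" if "n \<in> ?S" for n
    using that p(2) p0(3) Sigma_star_subset_A2[OF assms(1)] by auto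
  \<comment> \<open>The circles are constructed too, which gives both their genericity and their
    uniqueness.\<close>
  have Kc: "constructed_circle ?S q v (c v)" if v: "v \<in> odd_lattice" for v
  proof -
    have adj: "lattice_adj (v + evec l) v" for l
      by (auto simp: lattice_adj_def)
    have P: "constructed_point ?S q (v + evec l) (p (v + evec l))" for l
      using lattice_adj_parity[OF adj] v by (intro p(1)) simp
    have ne: "v + evec k \<noteq> v + evec l" if "k \<noteq> l" for k l
      using that by (auto simp: axis_eq_axis)
    show ?thesis
    proof (rule circle_through[OF adj adj adj])
      show "distinct [p (v + evec 1), p (v + evec 2), p (v + evec 3)]"
        using neighbours_distinct[OF gen P P ne adj adj] by simp
    qed (use P c v adj in auto)
  qed
  \<comment> \<open>Restriction makes the maps extensional, so that agreement on the sublattices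
    becomes equality.\<close>
  define p' c' where "p' = restrict p even_lattice" and "c' = restrict c odd_lattice"
  have pcc: "point_circle_complex p' c'"
    using c unfolding point_circle_complex_def p'_def c'_def by auto
  have "p m \<noteq> p n" if "m \<in> even_lattice" "n \<in> even_lattice" "nearby m n" for m n
    using that neighbours_distinct[OF gen p(1)[of m] p(1)[of n]] by (auto simp: nearby_def)
  moreover have "c v \<noteq> c v'" if "v \<in> odd_lattice" "v' \<in> odd_lattice" "nearby v v'" for v v'
    using that neighbour_circles_distinct[OF gen Kc[of v] Kc[of v']] by (auto simp: nearby_def)
  ultimately have gc: "generic_complex p' c'"
    unfolding generic_complex_def p'_def c'_def by simp
  have p'q: "p' n = q n" if "n \<in> ?S" for n
    using pq that S_even by (auto simp: p'_def)
  show ?thesis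
  proof (rule ex1I[of _ "(p', c')"])
    show "case (p', c') of (p, c) \<Rightarrow> point_circle_complex p c \<and> generic_complex p c \<and>
        (\<forall>n \<in> ?S. p n = q n)"
      using pcc gc p'q by simp
    fix d
    assume "case d of (p, c) \<Rightarrow> point_circle_complex p c \<and> generic_complex p c \<and>
        (\<forall>n \<in> ?S. p n = q n)"
    then obtain p1 c1 where d: "d = (p1, c1)" and pc1: "point_circle_complex p1 c1"
      and "generic_complex p1 c1" "\<forall>n\<in>?S. p1 n = q n"
      by (cases d) auto
    note eq = complex_eq_constructed[OF pc1 this(3) S_even this(4)]
    have "p1 = p'"
    proof (rule extensionalityI[of _ even_lattice])
      show "p1 \<in> extensional even_lattice" using pc1 unfolding point_circle_complex_def PiE_def by blast
      show "p1 n = p' n" if "n \<in> even_lattice" for n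
        using eq(1)[OF p(1)[OF that]] that by (simp add: p'_def)
    qed (simp add: p'_def)
    moreover have "c1 = c'"
    proof (rule extensionalityI[of _ odd_lattice])
      show "c1 \<in> extensional odd_lattice" using pc1 unfolding point_circle_complex_def PiE_def by blast
      show "c1 v = c' v" if "v \<in> odd_lattice" for v
        using eq(2)[OF Kc[OF that]] that by (simp add: c'_def)
    qed (simp add: c'_def)
    ultimately show "d = (p', c')" using d by simp
  qed
qed

end
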